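(* Assume that (Assumption 1) $H(i\omega_k):=CR(i\omega_k,A)B\neq 0$ for all $k\in\mathbb{Z}$; and (Assumption 2) $\big(H(i\omega_k)^{-1}[1-H_d(k)]f_k^{-1}\big)_{k\in\mathbb{Z}}\in\ell^2$, where $H_d(k):=CR(i\omega_k,A)P\theta_k$. Let $L\in\mathcal{L}(W,\mathbb{C})$ be the (bounded) operator $$Ly:=\sum_{k\in\mathbb{Z}}H(i\omega_k)^{-1}[1-H_d(k)]\langle y,\theta_k\rangle_{L^2},\qquad y\in W,$$ and suppose further that $BL+P$ is a conform operator for the semigroup $T_A(t)$. Then the state feedback regulation problem (SFRP) is solvable using $u(t)=Lw(t)$. Moreover, for every $y_r\in W$ the corresponding control law $u_{y_r}$ which achieves the asymptotic tracking of $y_r$ in the presence of the disturbance $\mathcal{U}_d(t)$ is given, for all $t\ge 0$, by $$u_{y_r}(t)=\sum_{k\in\mathbb{Z}}H(i\omega_k)^{-1}[1-H_d(k)]\langle y_r,\theta_k\rangle_{L^2}\,e^{i\omega_k t}.$$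
   Context: Plant. $Z$ is a complex Hilbert space with inner product $\langle\cdot,\cdot\rangle$, $U=Y=\mathbb{C}$, $B\in\mathcal{L}(\mathbb{C},Z)$, $C\in\mathcal{L}(Z,\mathbb{C})$, and the plant is $\dot z(t)=Az(t)+Bu(t)+\mathcal{U}_d(t)$, $y(t)=Cz(t)$, $t\ge0$, $z(0)=z_0\in Z$. Here $Az=\sum_{n\in\mathbb{Z}}\mu_n\langle z,\psi_n\rangle\phi_n$ with $D(A)=\{z\in Z:\sum_{n\in\mathbb{Z}}|\mu_n|^2|\langle z,\psi_n\rangle|^2<\infty\}$, where $(\phi_n)_{n\in\mathbb{Z}}$ is a Riesz basis of $Z$ and $(\psi_n)_{n\in\mathbb{Z}}$ is its biorthogonal sequence. The set $\{\mu_n\}_{n\in\mathbb{Z}}$ is contained in the open left half-plane $\mathbb{C}^-$, has no accumulation points on $i\mathbb{R}$, and there are constants $\alpha,c,d>0$ with $\mathrm{Re}\,\mu_n\le -c/|\mathrm{Im}\,\mu_n|^{\alpha}$ whenever $|\mathrm{Im}\,\mu_n|\ge d$. Then $A$ generates a bounded polynomially stable $C_0$-semigroup $T_A(t)$ on $Z$, with $\|T_A(t)A^{-1}\|\le Nt^{-1/\alpha}$ for some $N>0$ and all $t>0$. $R(\lambda,A)=(\lambda I-A)^{-1}$. (A $C_0$-semigroup $T(t)$ with generator $G$ is polynomially stable if there are $\alpha',\beta',N'>0$ with $\|T(t)(\mu I-G)^{-\alpha'}\|\le N't^{-\beta'}$ for all $t>0$, where $\mu$ is a real number with $\|T(t)\|\le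 Me^{(\mu-\varepsilon)t}$ for some $M,\varepsilon>0$ and all $t\ge0$.) Exosystem. Let $p>0$, $\omega_k=2\pi k/p$ for $k\in\mathbb{Z}$, and let $(f_k)_{k\in\mathbb{Z}}\subset\mathbb{R}$ with $f_k\ge1$ for all $k$ and $(f_k^{-1})_{k\in\mathbb{Z}}\in\ell^2$. Put $\theta_k(t)=e^{i\omega_k t}$. The space $$W=\Big\{y:\mathbb{R}\to\mathbb{C}\ \Big|\ y(t)=\sum_{k\in\mathbb{Z}}y_ke^{i\omega_k t},\ \sum_{k\in\mathbb{Z}}|y_k|^2f_k^2<\infty\Big\}$$ is a Hilbert space with inner product $\langle u,y\rangle_f=\sum_{k}u_k\overline{y_k}f_k^2$ and norm $\|y\|_f=(\sum_k|y_k|^2f_k^2)^{1/2}$, where $y_k=\langle y,\theta_k\rangle_{L^2}$ is the $k$-th Fourier coefficient of $y$ (the $L^2$-inner product over a period being normalized so that $\{\theta_k\}$ is orthonormal). The operator $S=\sum_k i\omega_k\langle\cdot,\theta_k\rangle_{L^2}\theta_k$ with $D(S)=\{y\in W:\sum_k\omega_k^2|\langle y,\theta_k\rangle_{L^2}|^2f_k^2<\infty\}$ generates the isometric $C_0$-group $T_S(t)=\sum_k e^{i\omega_k t}\langle\cdot,\theta_k\rangle_{L^2}\theta_k$ on $W$. Fix $P\in\mathcal{L}(W,Z)$ and $Q=\delta_0\in\mathcal{L}(W,\mathbb{C})$, $\delta_0y=y(0)$. The exosystem is $\dot w(t)=Sw(t)$, $w(0)=w_0\in W$, with reference signal $y_r(t)=Qw(t)$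 and disturbance $\mathcal{U}_d(t)=Pw(t)$; the reference signal $y_r\in W$ is generated by the choice $w_0=y_r$, so that then $\mathcal{U}_d(t)=PT_S(t)y_r$. SFRP with $u(t)=Lw(t)$ (i.e. feedback $K=0$). It is solved by $u(t)=Lw(t)$ if, $T_A(t)$ being bounded and polynomially stable, for the (mild) solutions of $\dot z(t)=Az(t)+(BL+P)w(t)$, $\dot w(t)=Sw(t)$, $t\ge0$, the tracking error $e(t)=Cz(t)-Qw(t)$ tends to $0$ as $t\to\infty$ for all initial conditions $z_0\in Z$, $w_0\in W$, and for all $z_0\in D(A)$, $w_0\in D(S)$ there is $m>0$ (depending on the initial conditions) with $|e(t)|\le m\,t^{-1/\alpha}$ for all $t>0$. Conform operator. An operator $\Delta\in\mathcal{L}(W,Z)$ is conform for $T_A(t)$ if $w\mapsto\int_0^\infty T_A(t)\Delta T_S(-t)w\,dt$, $w\in D(S)$ (improper integral), defines a linear bounded operator from $D(S)$ to $Z$, where $D(S)$ is endowed with the norm induced by $W$. *)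

theory Defs
  imports "HOL-Analysis.Analysis"
begin

text \<open>Complex Hilbert spaces; the inner product is linear in its first argument.\<close>

class complex_hilbert = banach +
  fixes scaleC :: "complex \<Rightarrow> 'a \<Rightarrow> 'a" (infixr "*\<^sub>C" 75)
    and cinner :: "'a \<Rightarrow> 'a \<Rightarrow> complex"
  assumes scaleC_add_right: "a *\<^sub>C (x + y) = a *\<^sub>C x + a *\<^sub>C y"
    and scaleC_add_left: "(a + b) *\<^sub>C x = a *\<^sub>C x + b *\<^sub>C x"
    and scaleC_scaleC: "a *\<^sub>C (b *\<^sub>C x) = (a * b) *\<^sub>C x"
    and scaleR_scaleC: "r *\<^sub>R x = complex_of_real r *\<^sub>C x"
    and cinner_commute: "cinner x y = cnj (cinner y x)"
    and cinner_add_left: "cinner (x + y) z = cinner x z + cinner y z"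
    and cinner_scaleC_left: "cinner (a *\<^sub>C x) y = a * cinner x y"
    and cinner_self: "cinner x x = complex_of_real ((norm x)\<^sup>2)"

instantiation complex :: complex_hilbert
begin

definition scaleC_complex :: "complex \<Rightarrow> complex \<Rightarrow> complex"
  where "scaleC_complex a x = a * x"

definition cinner_complex :: "complex \<Rightarrow> complex \<Rightarrow> complex"
  where "cinner_complex x y = x * cnj y"

instance
  by standard
    (auto simp: scaleC_complex_def cinner_complex_def algebra_simps scaleR_conv_of_real
      complex_norm_square simp del: of_real_power)

end

definition bounded_clinear :: "('a::complex_hilbert \<Rightarrow> 'b::complex_hilbert) \<Rightarrow> bool" where
  "bounded_clinear F \<longleftrightarrow> bounded_linear F \<and> (\<forall>a x. F (a *\<^sub>C x) = a *\<^sub>C F x)"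

definition ell2 :: "(int \<Rightarrow> 'a::real_normed_vector) \<Rightarrow> bool" where
  "ell2 x \<longleftrightarrow> (\<lambda>k. (norm (x k))\<^sup>2) summable_on UNIV"

definition riesz_basis :: "(int \<Rightarrow> 'z::complex_hilbert) \<Rightarrow> bool" where
  "riesz_basis \<phi> \<longleftrightarrow>
     closure {\<Sum>n\<in>F. a n *\<^sub>C \<phi> n | F a. finite F} = UNIV \<and>
     (\<exists>m>0. \<exists>M>0. \<forall>F a. finite F \<longrightarrow>
        m * (\<Sum>n\<in>F. (cmod (a n))\<^sup>2) \<le> (norm (\<Sum>n\<in>F. a n *\<^sub>C \<phi> n))\<^sup>2 \<and>
        (norm (\<Sum>n\<in>F. a n *\<^sub>C \<phi> n))\<^sup>2 \<le> M * (\<Sum>n\<in>F. (cmod (a n))\<^sup>2))"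

definition biorthogonal :: "(int \<Rightarrow> 'z::complex_hilbert) \<Rightarrow> (int \<Rightarrow> 'z) \<Rightarrow> bool" where
  "biorthogonal \<phi> \<psi> \<longleftrightarrow> (\<forall>n m. cinner (\<phi> n) (\<psi> m) = (if n = m then 1 else 0))"

text \<open>Unbounded operators are given by a total function together with their domain;
  values of the function outside the domain are irrelevant.\<close>

definition spectral_dom :: "(int \<Rightarrow> complex) \<Rightarrow> (int \<Rightarrow> 'z::complex_hilbert) \<Rightarrow> 'z set" where
  "spectral_dom \<mu> \<psi> =
     {z. (\<lambda>n. (cmod (\<mu> n))\<^sup>2 * (cmod (cinner z (\<psi> n)))\<^sup>2) summable_on UNIV}"

definition spectral_op ::
  "(int \<Rightarrow> complex) \<Rightarrow> (int \<Rightarrow> 'z::complex_hilbert) \<Rightarrow> (int \<Rightarrow> 'z) \<Rightarrow> 'z \<Rightarrow> 'z" where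
  "spectral_op \<mu> \<phi> \<psi> z = (\<Sum>\<^sub>\<infinity>n. (\<mu> n * cinner z (\<psi> n)) *\<^sub>C \<phi> n)"

definition resolvent :: "'z set \<Rightarrow> ('z \<Rightarrow> 'z) \<Rightarrow> complex \<Rightarrow> 'z::complex_hilbert \<Rightarrow> 'z" where
  "resolvent D A s = the_inv_into D (\<lambda>x. s *\<^sub>C x - A x)"

definition c0_semigroup :: "(real \<Rightarrow> 'z \<Rightarrow> 'z::complex_hilbert) \<Rightarrow> bool" where
  "c0_semigroup T \<longleftrightarrow>
     (\<forall>t\<ge>0. bounded_clinear (T t)) \<and>
     (\<forall>z. T 0 z = z) \<and>
     (\<forall>s\<ge>0. \<forall>t\<ge>0. \<forall>z. T (s + t) z = T s (T t z)) \<and>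
     (\<forall>z. ((\<lambda>t. T t z) \<longlongrightarrow> z) (at_right 0))"

definition is_generator :: "'z set \<Rightarrow> ('z \<Rightarrow> 'z) \<Rightarrow> (real \<Rightarrow> 'z \<Rightarrow> 'z::complex_hilbert) \<Rightarrow> bool" where
  "is_generator D A T \<longleftrightarrow>
     (\<forall>z y. ((\<lambda>h. (T h z - z) /\<^sub>R h) \<longlongrightarrow> y) (at_right 0) \<longleftrightarrow> z \<in> D \<and> y = A z)"

definition bounded_semigroup :: "(real \<Rightarrow> 'z \<Rightarrow> 'z::complex_hilbert) \<Rightarrow> bool" where
  "bounded_semigroup T \<longleftrightarrow> (\<exists>M. \<forall>t\<ge>0. \<forall>z. norm (T t z) \<le> M * norm z)"

text \<open>The fractional power \<open>(\<mu>I - G)\<^sup>-\<^sup>a\<close>, \<open>a > 0\<close>, of the generator \<open>G\<close> of \<open>T\<close>, given by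
  the usual Laplace-type formula, valid for real \<open>\<mu>\<close> above the growth bound of \<open>T\<close>. For
  \<open>a = 1\<close> it is the resolvent of \<open>G\<close> at \<open>\<mu>\<close>.\<close>

definition neg_frac_power ::
  "(real \<Rightarrow> 'z \<Rightarrow> 'z::complex_hilbert) \<Rightarrow> real \<Rightarrow> real \<Rightarrow> 'z \<Rightarrow> 'z" where
  "neg_frac_power T \<mu> a z =
     (1 / Gamma a) *\<^sub>R integral {0..} (\<lambda>t. (t powr (a - 1) * exp (- \<mu> * t)) *\<^sub>R T t z)"

definition polynomially_stable :: "(real \<Rightarrow> 'z \<Rightarrow> 'z::complex_hilbert) \<Rightarrow> bool" where
  "polynomially_stable T \<longleftrightarrow>
     (\<exists>\<mu>. (\<exists>M>0. \<exists>\<epsilon>>0. \<forall>t\<ge>0. \<forall>z. norm (T t z) \<le> M * exp ((\<mu> - \<epsilon>) * t) * norm z) \<and>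
       (\<exists>a>0. \<exists>b>0. \<exists>N>0. \<forall>t>0. \<forall>z.
          norm (T t (neg_frac_power T \<mu> a z)) \<le> N * t powr (- b) * norm z))"

definition omega :: "real \<Rightarrow> int \<Rightarrow> real" where
  "omega p k = 2 * pi * real_of_int k / p"

definition theta :: "real \<Rightarrow> int \<Rightarrow> real \<Rightarrow> complex" where
  "theta p k t = exp (\<i> * complex_of_real (omega p k * t))"

definition L2_inner :: "real \<Rightarrow> (real \<Rightarrow> complex) \<Rightarrow> (real \<Rightarrow> complex) \<Rightarrow> complex" where
  "L2_inner p u v = integral {0..p} (\<lambda>t. u t * cnj (v t)) / complex_of_real p"

definition W_space :: "real \<Rightarrow> (int \<Rightarrow> real) \<Rightarrow> (real \<Rightarrow> complex) set" where
  "W_space p f =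
     {y. \<exists>c. (\<lambda>k. (cmod (c k))\<^sup>2 * (f k)\<^sup>2) summable_on UNIV \<and>
             (\<forall>t. ((\<lambda>k. c k * theta p k t) has_sum y t) UNIV)}"

definition W_norm :: "real \<Rightarrow> (int \<Rightarrow> real) \<Rightarrow> (real \<Rightarrow> complex) \<Rightarrow> real" where
  "W_norm p f y = sqrt (\<Sum>\<^sub>\<infinity>k. (cmod (L2_inner p y (theta p k)))\<^sup>2 * (f k)\<^sup>2)"

definition S_dom :: "real \<Rightarrow> (int \<Rightarrow> real) \<Rightarrow> (real \<Rightarrow> complex) set" where
  "S_dom p f =
     {y \<in> W_space p f.
        (\<lambda>k. (omega p k)\<^sup>2 * (cmod (L2_inner p y (theta p k)))\<^sup>2 * (f k)\<^sup>2) summable_on UNIV}"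

text \<open>The group on \<open>W\<close> generated by \<open>S\<close>, so the mild solution of \<open>w' = S w\<close>, \<open>w(0) = w0\<close>, is
  \<open>T_S p t w0\<close>. The series is evaluated pointwise, which agrees with its limit in
  \<open>W\<close> because point evaluations are continuous on \<open>W\<close>.\<close>

definition T_S :: "real \<Rightarrow> real \<Rightarrow> (real \<Rightarrow> complex) \<Rightarrow> (real \<Rightarrow> complex)" where
  "T_S p t y = (\<lambda>s. \<Sum>\<^sub>\<infinity>k. exp (\<i> * complex_of_real (omega p k * t))
                          * L2_inner p y (theta p k) * theta p k s)"

text \<open>Bounded complex-linear operators on a subspace \<open>X\<close> of functions, normed by \<open>nrm\<close>.\<close>

definition bounded_clinear_on ::
  "(real \<Rightarrow> complex) set \<Rightarrow> ((real \<Rightarrow> complex) \<Rightarrow> real)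
     \<Rightarrow> ((real \<Rightarrow> complex) \<Rightarrow> 'v::complex_hilbert) \<Rightarrow> bool" where
  "bounded_clinear_on X nrm F \<longleftrightarrow>
     (\<forall>u\<in>X. \<forall>v\<in>X. F (\<lambda>t. u t + v t) = F u + F v) \<and>
     (\<forall>a. \<forall>u\<in>X. F (\<lambda>t. a * u t) = a *\<^sub>C F u) \<and>
     (\<exists>M. \<forall>u\<in>X. norm (F u) \<le> M * nrm u)"

definition conform_operator ::
  "real \<Rightarrow> (int \<Rightarrow> real) \<Rightarrow> (real \<Rightarrow> 'z \<Rightarrow> 'z)
     \<Rightarrow> ((real \<Rightarrow> complex) \<Rightarrow> 'z::complex_hilbert) \<Rightarrow> bool" where
  "conform_operator p f T \<Delta> \<longleftrightarrow>
     bounded_clinear_on (W_space p f) (W_norm p f) \<Delta> \<and>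
     (\<exists>G. bounded_clinear_on (S_dom p f) (W_norm p f) G \<and>
       (\<forall>w\<in>S_dom p f.
          ((\<lambda>\<tau>. integral {0..\<tau>} (\<lambda>t. T t (\<Delta> (T_S p (- t) w)))) \<longlongrightarrow> G w) at_top))"

definition mild_solution ::
  "(real \<Rightarrow> 'z \<Rightarrow> 'z) \<Rightarrow> (real \<Rightarrow> 'z::complex_hilbert) \<Rightarrow> 'z \<Rightarrow> real \<Rightarrow> 'z" where
  "mild_solution T g z0 t = T t z0 + integral {0..t} (\<lambda>s. T (t - s) (g s))"

text \<open>\<open>e(t) = C z(t) - Q w(t)\<close>, where \<open>w(t) = T_S(t) w0\<close> and \<open>Q\<close> is evaluation at \<open>0\<close>.\<close>

definition tracking_error ::
  "real \<Rightarrow> (real \<Rightarrow> 'z \<Rightarrow> 'z) \<Rightarrow> (complex \<Rightarrow> 'z) \<Rightarrow> ('z::complex_hilbert \<Rightarrow> complex)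
     \<Rightarrow> ((real \<Rightarrow> complex) \<Rightarrow> 'z) \<Rightarrow> ((real \<Rightarrow> complex) \<Rightarrow> complex)
     \<Rightarrow> 'z \<Rightarrow> (real \<Rightarrow> complex) \<Rightarrow> real \<Rightarrow> complex" where
  "tracking_error p T B C P L z0 w0 t =
     C (mild_solution T (\<lambda>s. B (L (T_S p s w0)) + P (T_S p s w0)) z0 t) - T_S p t w0 0"

definition SFRP_solved_by ::
  "real \<Rightarrow> (int \<Rightarrow> real) \<Rightarrow> real \<Rightarrow> 'z set \<Rightarrow> (real \<Rightarrow> 'z \<Rightarrow> 'z) \<Rightarrow> (complex \<Rightarrow> 'z)
     \<Rightarrow> ('z::complex_hilbert \<Rightarrow> complex) \<Rightarrow> ((real \<Rightarrow> complex) \<Rightarrow> 'z)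
     \<Rightarrow> ((real \<Rightarrow> complex) \<Rightarrow> complex) \<Rightarrow> bool" where
  "SFRP_solved_by p f \<alpha> DA T B C P L \<longleftrightarrow>
     bounded_clinear_on (W_space p f) (W_norm p f) L \<and>
     bounded_semigroup T \<and> polynomially_stable T \<and>
     (\<forall>z0. \<forall>w0\<in>W_space p f. (tracking_error p T B C P L z0 w0 \<longlongrightarrow> 0) at_top) \<and>
     (\<forall>z0\<in>DA. \<forall>w0\<in>S_dom p f. \<exists>m>0. \<forall>t>0.
        cmod (tracking_error p T B C P L z0 w0 t) \<le> m * t powr (- (1 / \<alpha>)))"

end

theory Submission
  imports Defs
begin

text \<open>
  Write \<open>\<Delta> = B L + P\<close> for the total input operator and \<open>\<pi>\<close> for the conform integral
  \<open>w \<mapsto> \<integral>\<^sub>0\<^sup>\<infinity> T\<^sub>A(t) \<Delta> T\<^sub>S(-t) w dt\<close>. The mild solution should split into the periodic motion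
  \<open>\<pi> T\<^sub>S(t) w\<^sub>0\<close> and the free motion \<open>T\<^sub>A(t) (z\<^sub>0 - \<pi> w\<^sub>0)\<close>, and the choice of \<open>L\<close> makes the output of the
  periodic motion equal to the reference. The error is then \<open>C T\<^sub>A(t) (z\<^sub>0 - \<pi> w\<^sub>0)\<close>, which tends to zero
  because the semigroup is strongly stable, and which decays at the rate \<open>t\<^sup>-\<^sup>1\<^sup>/\<^sup>\<alpha>\<close> when
  \<open>z\<^sub>0 - \<pi> w\<^sub>0\<close> lies in the domain of \<open>A\<close>.

  The hypothesis only gives \<open>\<pi>\<close> on \<open>D(S)\<close>, as a bounded operator in the norm of \<open>W\<close>. Everything is
  therefore reduced to its values \<open>g\<^sub>k = \<pi> \<theta>\<^sub>k\<close> on the characters. Boundedness says that they satisfy a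
  Bessel inequality with the weights \<open>f\<^sub>k\<close> (\<open>operator_bessel\<close>), so that \<open>\<Sum> w\<^sub>k g\<^sub>k\<close> converges for every
  \<open>w \<in> W\<close> and serves as the extension of \<open>\<pi>\<close> to \<open>W\<close>. On a character the conform integral is a
  Laplace integral of the semigroup, hence \<open>g\<^sub>k = R(i \<omega>\<^sub>k, A) \<Delta> \<theta>\<^sub>k\<close>
  (\<open>conform_integral_on_character\<close>). From this:

  \<^item> \<open>C g\<^sub>k = H(i \<omega>\<^sub>k) L \<theta>\<^sub>k + H\<^sub>d(k) = 1 = \<theta>\<^sub>k(0)\<close>;
  \<^item> the response to one harmonic splits as above by an explicit integration (\<open>harmonic_response\<close>), and
    the splitting passes to all of \<open>W\<close> by uniform convergence on compact time intervals
    (\<open>periodic_response\<close>);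
  \<^item> for \<open>w \<in> D(S)\<close> the state \<open>\<Sum> w\<^sub>k g\<^sub>k\<close> lies in \<open>D(A)\<close>, because the coordinate form of
    \<open>A \<pi> = \<pi> S - \<Delta>\<close> exhibits \<open>\<mu>\<^sub>n\<close> times its coordinates as the coordinates of a vector
    (\<open>periodic_state_in_domain\<close>).

  On the plant side all statements about \<open>A\<close> are read off coordinates in the Riesz basis. The one
  point where this needs an argument is that the given semigroup acts on \<open>\<phi>\<^sub>n\<close> by \<open>e\<^sup>\<mu>\<^sup>t\<close> with
  \<open>\<mu> = \<mu>\<^sub>n\<close> (\<open>semigroup_eigenvector\<close>), which uses the uniform boundedness principle. Then \<open>T\<^sub>A(t)\<close> and its
  resolvents are diagonal, boundedness and strong stability follow from \<open>Re \<mu>\<^sub>n < 0\<close>, and the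
  polynomial rate is a bound on \<open>e\<^sup>\<mu>\<^sup>t / \<mu>\<close> at \<open>\<mu> = \<mu>\<^sub>n\<close>, uniform in \<open>n\<close> (\<open>ex_mode_decay\<close>).
\<close>

section \<open>Complex Hilbert spaces\<close>

lemma scaleC_zero_left [simp]: "0 *\<^sub>C (x::'a::complex_hilbert) = 0"
  using scaleR_scaleC[of 0 x] by simp

lemma scaleC_one [simp]: "1 *\<^sub>C (x::'a::complex_hilbert) = x"
  using scaleR_scaleC[of 1 x] by simp

lemma scaleC_zero_right [simp]: "a *\<^sub>C (0::'a::complex_hilbert) = 0"
  using scaleC_add_right[of a "0::'a" 0] by simp

lemma scaleC_minus_left: "(- a) *\<^sub>C (x::'a::complex_hilbert) = - (a *\<^sub>C x)"
  using scaleC_add_left[of a "- a" x] by (simp add: eq_neg_iff_add_eq_0 add.commute)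

lemma scaleC_diff_left: "(a - b) *\<^sub>C (x::'a::complex_hilbert) = a *\<^sub>C x - b *\<^sub>C x"
  using scaleC_add_left[of a "- b" x] by (simp add: scaleC_minus_left)

lemma scaleC_minus_right: "a *\<^sub>C (- x::'a::complex_hilbert) = - (a *\<^sub>C x)"
  using scaleC_add_right[of a x "- x"] by (simp add: eq_neg_iff_add_eq_0 add.commute)

lemma scaleC_diff_right: "a *\<^sub>C (x - y::'a::complex_hilbert) = a *\<^sub>C x - a *\<^sub>C y"
  using scaleC_add_right[of a x "- y"] by (simp add: scaleC_minus_right)

lemma scaleC_complex [simp]: "a *\<^sub>C (x::complex) = a * x"
  by (simp add: scaleC_complex_def)

lemma cinner_zero_left [simp]: "cinner 0 (y::'a::complex_hilbert) = 0"
  using cinner_scaleC_left[of 0 0 y] by simp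

lemma cinner_diff_left: "cinner (x - y) (z::'a::complex_hilbert) = cinner x z - cinner y z"
  using cinner_add_left[of "x - y" y z] by simp

lemma cinner_scaleC_right: "cinner x (a *\<^sub>C y) = cnj a * cinner x (y::'a::complex_hilbert)"
  by (metis cinner_commute cinner_scaleC_left complex_cnj_mult)

lemma cinner_diff_right: "cinner x (y - z) = cinner x y - cinner x (z::'a::complex_hilbert)"
  by (metis cinner_commute cinner_diff_left complex_cnj_diff)

lemma norm_scaleC: "norm (a *\<^sub>C (x::'a::complex_hilbert)) = cmod a * norm x"
proof -
  have "complex_of_real ((norm (a *\<^sub>C x))\<^sup>2) = a * cnj a * complex_of_real ((norm x)\<^sup>2)"
    unfolding cinner_self[symmetric] by (simp add: cinner_scaleC_left cinner_scaleC_right)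
  also have "\<dots> = complex_of_real ((cmod a * norm x)\<^sup>2)"
    by (simp only: complex_norm_square[symmetric] power_mult_distrib of_real_mult)
  finally have "(norm (a *\<^sub>C x))\<^sup>2 = (cmod a * norm x)\<^sup>2"
    using of_real_eq_iff by blast
  then show ?thesis by simp
qed

lemma cmod_cinner_le: "cmod (cinner x y) \<le> norm x * norm (y::'a::complex_hilbert)"
proof (cases "y = 0")
  case True
  have "cinner x 0 = 0" by (metis cinner_commute cinner_zero_left complex_cnj_zero)
  with True show ?thesis by simp
next
  case False
  define n where "n = (norm y)\<^sup>2"
  have n: "n > 0" using False by (simp add: n_def)
  define a where "a = cinner x y / complex_of_real n"
  have yx: "cinner y x = cnj (cinner x y)" by (rule cinner_commute)
  \<comment> \<open>Expand the square of the distance from \<open>x\<close> to its projection \<open>a y\<close> onto the line of \<open>y\<close>.\<close>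
  have "complex_of_real ((norm (x - a *\<^sub>C y))\<^sup>2)
      = complex_of_real ((norm x)\<^sup>2) - cnj a * cinner x y - a * cnj (cinner x y)
        + a * cnj a * complex_of_real n"
    unfolding n_def cinner_self[symmetric]
    by (simp add: cinner_diff_left cinner_diff_right cinner_scaleC_left cinner_scaleC_right
        yx algebra_simps)
  also have "\<dots> = complex_of_real ((norm x)\<^sup>2) - cinner x y * cnj (cinner x y) / complex_of_real n"
    using n by (simp add: a_def field_simps)
  also have "\<dots> = complex_of_real ((norm x)\<^sup>2 - (cmod (cinner x y))\<^sup>2 / n)"
    by (simp only: complex_norm_square[symmetric] of_real_diff of_real_divide)
  finally have "(norm (x - a *\<^sub>C y))\<^sup>2 = (norm x)\<^sup>2 - (cmod (cinner x y))\<^sup>2 / n"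
    using of_real_eq_iff by blast
  then have "(cmod (cinner x y))\<^sup>2 / n \<le> (norm x)\<^sup>2"
    by (metis diff_ge_0_iff_ge zero_le_power2)
  then have "(cmod (cinner x y))\<^sup>2 \<le> (norm x * norm y)\<^sup>2"
    using n by (simp add: n_def power_mult_distrib divide_le_eq)
  then show ?thesis by (simp add: abs_le_square_iff[symmetric])
qed

lemma bounded_linear_scaleC_right: "bounded_linear (\<lambda>x::'a::complex_hilbert. a *\<^sub>C x)"
proof
  show "a *\<^sub>C (r *\<^sub>R x) = r *\<^sub>R (a *\<^sub>C x)" for r and x :: 'a
    by (simp add: scaleR_scaleC scaleC_scaleC mult.commute)
  show "\<exists>K. \<forall>x::'a. norm (a *\<^sub>C x) \<le> norm x * K"
    by (rule exI[of _ "cmod a"]) (simp add: norm_scaleC mult.commute)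
qed (rule scaleC_add_right)

lemma bounded_linear_scaleC_left: "bounded_linear (\<lambda>a. a *\<^sub>C (x::'a::complex_hilbert))"
proof
  show "(r *\<^sub>R a) *\<^sub>C x = r *\<^sub>R (a *\<^sub>C x)" for r and a
    by (simp add: scaleR_scaleC scaleC_scaleC scaleR_conv_of_real)
  show "\<exists>K. \<forall>a. norm (a *\<^sub>C x) \<le> norm a * K"
    by (rule exI[of _ "norm x"]) (simp add: norm_scaleC)
qed (rule scaleC_add_left)

lemma bounded_linear_cinner_left: "bounded_linear (\<lambda>x::'a::complex_hilbert. cinner x y)"
proof
  show "cinner (r *\<^sub>R x) y = r *\<^sub>R cinner x y" for r and x :: 'a
    by (simp add: scaleR_scaleC cinner_scaleC_left scaleR_conv_of_real)
  show "\<exists>K. \<forall>x::'a. norm (cinner x y) \<le> norm x * K"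
    by (rule exI[of _ "norm y"]) (simp add: cmod_cinner_le)
qed (rule cinner_add_left)

lemmas cinner_sum_left = linear_sum[OF bounded_linear.linear[OF bounded_linear_cinner_left]]
lemmas cinner_has_sum = has_sum_bounded_linear[OF bounded_linear_cinner_left]
lemmas scaleC_has_sum = has_sum_bounded_linear[OF bounded_linear_scaleC_right]

lemma continuous_on_scaleC [continuous_intros]:
  fixes x :: "'a::complex_hilbert"
  assumes "continuous_on S a"
  shows "continuous_on S (\<lambda>s. a s *\<^sub>C x)"
  using bounded_linear.continuous_on[OF bounded_linear_scaleC_left assms] .

lemma bounded_clinearD:
  assumes "bounded_clinear F"
  shows "bounded_linear F" "F (a *\<^sub>C x) = a *\<^sub>C F x"
    "F (x + y) = F x + F y" "F (x - y) = F x - F y" "F 0 = 0"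
    "F (\<Sum>k\<in>I. c k *\<^sub>C g k) = (\<Sum>k\<in>I. c k *\<^sub>C F (g k))"
proof -
  show bl: "bounded_linear F" and *: "\<And>a x. F (a *\<^sub>C x) = a *\<^sub>C F x"
    using assms by (auto simp: bounded_clinear_def)
  interpret bounded_linear F by (rule bl)
  show "F (x + y) = F x + F y" "F (x - y) = F x - F y" "F 0 = 0"
    by (rule add diff zero)+
  show "F (\<Sum>k\<in>I. c k *\<^sub>C g k) = (\<Sum>k\<in>I. c k *\<^sub>C F (g k))"
    by (simp add: sum *)
qed

section \<open>Series controlled by weighted square sums\<close>

text \<open>An unconditional Cauchy criterion for a Banach space. The hypothesis replaces orthogonality: it
  bounds each finite block of the series by the same block of a convergent real series. The
  estimate over an arbitrary index set \<open>A\<close> is meant for tails.\<close>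

lemma
  fixes x :: "'i \<Rightarrow> 'a::banach" and q :: "'i \<Rightarrow> real"
  assumes x: "\<And>F. finite F \<Longrightarrow> (norm (sum x F))\<^sup>2 \<le> K * sum q F"
    and K: "K \<ge> 0" and q: "\<And>i. q i \<ge> 0" "q summable_on UNIV"
  shows summable_on_square_bound: "x summable_on UNIV"
    and norm_infsum_square_bound: "(norm (infsum x A))\<^sup>2 \<le> K * infsum q A"
proof -
  have "\<exists>P. eventually P (finite_subsets_at_top UNIV) \<and>
      (\<forall>F G. P F \<and> P G \<longrightarrow> dist (sum x F) (sum x G) < e)" if e: "e > 0" for e
  proof -
    define d where "d = (e/3)\<^sup>2 / (K + 1)"
    have d: "d > 0" using e K by (simp add: d_def)
    obtain F0 where F0: "finite F0" "dist (sum q F0) (infsum q UNIV) \<le> d / 2"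
      using infsum_finite_approximation[OF q(2), of "d/2"] d by auto
    have small: "norm (sum x H) \<le> e / 3" if H: "finite H" "H \<inter> F0 = {}" for H
    proof -
      have "sum q (H \<union> F0) \<le> infsum q UNIV"
        using finite_sum_le_infsum[OF q(2), of "H \<union> F0"] H F0 q by auto
      moreover have "infsum q UNIV - sum q F0 \<le> d"
        using F0(2) d unfolding dist_real_def by linarith
      ultimately have "sum q H \<le> d"
        using sum.union_disjoint[OF H(1) F0(1) H(2), of q] by linarith
      then have "K * sum q H \<le> (K + 1) * d"
        using K sum_nonneg[of H q] q d by (intro mult_mono) auto
      also have "\<dots> = (e/3)\<^sup>2" using K by (simp add: d_def)
      finally have "(norm (sum x H))\<^sup>2 \<le> (e/3)\<^sup>2" using x[OF H(1)] by linarith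
      then show ?thesis by (rule power2_le_imp_le) (use e in simp)
    qed
    have "eventually (\<lambda>F. finite F \<and> F0 \<subseteq> F) (finite_subsets_at_top (UNIV::'i set))"
      using F0(1) unfolding eventually_finite_subsets_at_top by auto
    moreover have "dist (sum x F) (sum x G) < e"
      if "finite F" "F0 \<subseteq> F" "finite G" "F0 \<subseteq> G" for F G
    proof -
      have *: "sum x F = sum x (F \<inter> G) + sum x (F - G)" "sum x G = sum x (F \<inter> G) + sum x (G - F)"
        using that by (metis sum.Int_Diff Int_commute)+
      have "norm (sum x (F - G)) \<le> e/3" "norm (sum x (G - F)) \<le> e/3"
        using that by (intro small; auto)+
      then show ?thesis
        using e norm_triangle_ineq4[of "sum x (F - G)" "sum x (G - F)"] unfolding * dist_norm by auto
    qed
    ultimately show ?thesis by blast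
  qed
  then have "cauchy_filter (filtermap (sum x) (finite_subsets_at_top UNIV))"
    by (simp add: cauchy_filter_metric_filtermap)
  moreover have "complete (UNIV::'a set)"
    by (meson Cauchy_convergent UNIV_I complete_def convergent_def)
  ultimately obtain L where "(sum x \<longlongrightarrow> L) (finite_subsets_at_top UNIV)"
    using complete_uniform[where S="UNIV::'a set"] by (force simp add: filterlim_def)
  then show xs: "x summable_on UNIV"
    using summable_on_def has_sum_def by blast
  then have xA: "x summable_on A" by (rule summable_on_subset_banach) simp
  have qA: "q summable_on A" using q(2) by (rule summable_on_subset_banach) simp
  show "(norm (infsum x A))\<^sup>2 \<le> K * infsum q A"
  proof (rule tendsto_le[OF _ tendsto_mult_left tendsto_power[OF tendsto_norm]])
    show "(sum x \<longlongrightarrow> infsum x A) (finite_subsets_at_top A)" using xA by (rule infsum_tendsto)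
    show "(sum q \<longlongrightarrow> infsum q A) (finite_subsets_at_top A)" using qA by (rule infsum_tendsto)
    show "\<forall>\<^sub>F F in finite_subsets_at_top A. (norm (sum x F))\<^sup>2 \<le> K * sum q F"
      by (rule eventually_finite_subsets_at_top_weakI) (use x in auto)
  qed simp
qed

lemma infsum_Compl_tendsto_0:
  fixes q :: "'i \<Rightarrow> real"
  assumes "q summable_on UNIV"
  shows "((\<lambda>F. infsum q (- F)) \<longlongrightarrow> 0) (finite_subsets_at_top UNIV)"
proof -
  have "((\<lambda>F. infsum q UNIV - sum q F) \<longlongrightarrow> infsum q UNIV - infsum q UNIV) (finite_subsets_at_top UNIV)"
    by (intro tendsto_intros infsum_tendsto assms)
  moreover have "infsum q UNIV - sum q F = infsum q (- F)" if "finite F" for F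
  proof -
    have "infsum q (F \<union> - F) = infsum q F + infsum q (- F)"
      using that assms by (intro infsum_Un_disjoint summable_on_subset_banach[OF assms]) auto
    then show ?thesis using that by (simp add: Compl_partition)
  qed
  ultimately show ?thesis
    by (subst tendsto_cong[of _ "\<lambda>F. infsum q UNIV - sum q F"])
      (auto intro!: eventually_finite_subsets_at_top_weakI)
qed

text \<open>If the comparison series does not depend on the parameter, neither do the tails.\<close>

lemma uniform_limit_sum_square_bound:
  fixes x :: "'s \<Rightarrow> 'i \<Rightarrow> 'a::banach" and q :: "'i \<Rightarrow> real"
  assumes x: "\<And>s F. s \<in> S \<Longrightarrow> finite F \<Longrightarrow> (norm (sum (x s) F))\<^sup>2 \<le> K * sum q F"
    and K: "K \<ge> 0" and q: "\<And>i. q i \<ge> 0" "q summable_on UNIV"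
  shows "uniform_limit S (\<lambda>F s. sum (x s) F) (\<lambda>s. infsum (x s) UNIV) (finite_subsets_at_top UNIV)"
proof (rule uniform_limitI)
  fix e :: real assume e: "e > 0"
  have "((\<lambda>F. K * infsum q (- F)) \<longlongrightarrow> K * 0) (finite_subsets_at_top UNIV)"
    by (intro tendsto_intros infsum_Compl_tendsto_0 q)
  then have "\<forall>\<^sub>F F in finite_subsets_at_top UNIV. K * infsum q (- F) < e\<^sup>2"
    using e by (intro order_tendstoD(2)) auto
  moreover have "\<forall>\<^sub>F F in finite_subsets_at_top (UNIV::'i set). finite F"
    by (rule eventually_finite_subsets_at_top_weakI) auto
  ultimately show "\<forall>\<^sub>F F in finite_subsets_at_top UNIV.
      \<forall>s\<in>S. dist (sum (x s) F) (infsum (x s) UNIV) < e"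
  proof eventually_elim
    case (elim F)
    show ?case
    proof
      fix s assume s: "s \<in> S"
      have xs: "x s summable_on UNIV"
        by (rule summable_on_square_bound[OF x K q]) (use s in auto)
      have "infsum (x s) (F \<union> - F) = infsum (x s) F + infsum (x s) (- F)"
        using elim by (intro infsum_Un_disjoint summable_on_subset_banach[OF xs]) auto
      then have "dist (sum (x s) F) (infsum (x s) UNIV) = norm (infsum (x s) (- F))"
        using elim by (simp add: Compl_partition dist_norm)
      moreover have "(norm (infsum (x s) (- F)))\<^sup>2 \<le> K * infsum q (- F)"
        by (rule norm_infsum_square_bound[OF x K q]) (use s in auto)
      ultimately show "dist (sum (x s) F) (infsum (x s) UNIV) < e"
        using elim(1) e by (metis le_less_trans less_imp_le power2_less_imp_less)
    qed
  qed
qed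

text \<open>A Bessel bound with weights \<open>v\<close> says that the synthesis map \<open>a \<mapsto> \<Sum> a k g k\<close> is bounded on the
  weighted square-summable sequences. With \<open>v = 1\<close> it is the upper half of the Riesz basis
  property; with \<open>v = f\<close> it is what is left of the boundedness of an operator on \<open>W\<close> when only its
  values \<open>g\<close> on the characters are kept.\<close>

definition bessel :: "real \<Rightarrow> (int \<Rightarrow> real) \<Rightarrow> (int \<Rightarrow> 'a::complex_hilbert) \<Rightarrow> bool" where
  "bessel K v g \<longleftrightarrow> K \<ge> 0 \<and>
     (\<forall>F a. finite F \<longrightarrow> (norm (\<Sum>k\<in>F. a k *\<^sub>C g k))\<^sup>2 \<le> K * (\<Sum>k\<in>F. (cmod (a k))\<^sup>2 * (v k)\<^sup>2))"

definition sq_summable :: "(int \<Rightarrow> real) \<Rightarrow> (int \<Rightarrow> complex) \<Rightarrow> bool" where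
  "sq_summable v a \<longleftrightarrow> (\<lambda>k. (cmod (a k))\<^sup>2 * (v k)\<^sup>2) summable_on UNIV"

lemma
  assumes "bessel K v g" "sq_summable v a"
  shows bessel_norm: "(norm (\<Sum>\<^sub>\<infinity>k. a k *\<^sub>C g k))\<^sup>2 \<le> K * (\<Sum>\<^sub>\<infinity>k. (cmod (a k))\<^sup>2 * (v k)\<^sup>2)"
    and bessel_has_sum: "((\<lambda>k. a k *\<^sub>C g k) has_sum (\<Sum>\<^sub>\<infinity>k. a k *\<^sub>C g k)) UNIV"
proof -
  have 1: "(norm (\<Sum>k\<in>F. a k *\<^sub>C g k))\<^sup>2 \<le> K * (\<Sum>k\<in>F. (cmod (a k))\<^sup>2 * (v k)\<^sup>2)"
    if "finite F" for F
    using assms that by (auto simp: bessel_def)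
  have K: "K \<ge> 0" using assms by (auto simp: bessel_def)
  have "(\<lambda>k. a k *\<^sub>C g k) summable_on UNIV"
    by (rule summable_on_square_bound[OF 1 K]) (use assms in \<open>auto simp: sq_summable_def\<close>)
  then show "((\<lambda>k. a k *\<^sub>C g k) has_sum (\<Sum>\<^sub>\<infinity>k. a k *\<^sub>C g k)) UNIV" by simp
  show "(norm (\<Sum>\<^sub>\<infinity>k. a k *\<^sub>C g k))\<^sup>2 \<le> K * (\<Sum>\<^sub>\<infinity>k. (cmod (a k))\<^sup>2 * (v k)\<^sup>2)"
    by (rule norm_infsum_square_bound[OF 1 K]) (use assms in \<open>auto simp: sq_summable_def\<close>)
qed

lemma sq_summable_le:
  assumes "sq_summable v a" "\<And>k. cmod (b k) \<le> N * cmod (a k)"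
  shows "sq_summable v b"
  unfolding sq_summable_def
proof (rule summable_on_comparison_test)
  show "(\<lambda>k. N\<^sup>2 * ((cmod (a k))\<^sup>2 * (v k)\<^sup>2)) summable_on UNIV"
    using assms(1) unfolding sq_summable_def by (rule summable_on_cmult_right)
  show "(cmod (b k))\<^sup>2 * (v k)\<^sup>2 \<le> N\<^sup>2 * ((cmod (a k))\<^sup>2 * (v k)\<^sup>2)" for k
  proof -
    have "(cmod (b k))\<^sup>2 \<le> (N * cmod (a k))\<^sup>2" by (rule power_mono[OF assms(2)]) simp
    then show ?thesis
      by (simp only: power_mult_distrib mult.assoc[symmetric] mult_right_mono zero_le_power2)
  qed
qed simp

lemma sq_summable_add:
  assumes "sq_summable v a" "sq_summable v b"
  shows "sq_summable v (\<lambda>k. a k + b k)"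
  unfolding sq_summable_def
proof (rule summable_on_comparison_test)
  show "(\<lambda>k. 2 * ((cmod (a k))\<^sup>2 * (v k)\<^sup>2) + 2 * ((cmod (b k))\<^sup>2 * (v k)\<^sup>2)) summable_on UNIV"
    using assms unfolding sq_summable_def by (intro summable_on_add summable_on_cmult_right)
  show "(cmod (a k + b k))\<^sup>2 * (v k)\<^sup>2
      \<le> 2 * ((cmod (a k))\<^sup>2 * (v k)\<^sup>2) + 2 * ((cmod (b k))\<^sup>2 * (v k)\<^sup>2)" for k
  proof -
    have "(cmod (a k + b k))\<^sup>2 \<le> (cmod (a k) + cmod (b k))\<^sup>2"
      by (simp add: power_mono norm_triangle_ineq)
    also have "\<dots> \<le> 2 * (cmod (a k))\<^sup>2 + 2 * (cmod (b k))\<^sup>2"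
      using sum_squares_bound[of "cmod (a k)" "cmod (b k)"] by (simp add: power2_sum)
    finally have "(cmod (a k + b k))\<^sup>2 * (v k)\<^sup>2 \<le> (2 * (cmod (a k))\<^sup>2 + 2 * (cmod (b k))\<^sup>2) * (v k)\<^sup>2"
      by (rule mult_right_mono) simp
    then show ?thesis by (simp add: algebra_simps)
  qed
qed simp

lemma sq_summable_scale: "sq_summable v a \<Longrightarrow> sq_summable v (\<lambda>k. s * a k)"
  by (rule sq_summable_le[of v a _ "cmod s"]) (auto simp: norm_mult)

lemma sq_summable_phase:
  "sq_summable v a \<Longrightarrow> (\<And>k. cmod (e k) \<le> 1) \<Longrightarrow> sq_summable v (\<lambda>k. e k * a k)"
  by (rule sq_summable_le[of v a _ 1]) (auto simp: norm_mult mult_left_le_one_le)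

lemma sq_summable_restrict: "sq_summable v a \<Longrightarrow> sq_summable v (\<lambda>k. if k \<in> A then a k else 0)"
  by (rule sq_summable_le[of v a _ 1]) auto

lemma sq_summable_finite: "finite F \<Longrightarrow> sq_summable v (\<lambda>k. if k \<in> F then a k else 0)"
  unfolding sq_summable_def
  by (rule finite_nonzero_values_imp_summable_on) (auto intro: finite_subset[of _ F])

text \<open>Multiplying the coefficients by numbers of modulus at most one that vary continuously with a
  parameter gives a continuous function, because the tails are small uniformly in the parameter.
  Orbits of the semigroup and Fourier series are both of this kind.\<close>

lemma
  fixes g :: "int \<Rightarrow> 'a::complex_hilbert"
  assumes g: "bessel K v g" and a: "sq_summable v a"
    and e: "\<And>s k. s \<in> S \<Longrightarrow> cmod (e s k) \<le> 1"
  shows bessel_uniform_limit: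
    "uniform_limit S (\<lambda>F s. \<Sum>k\<in>F. (e s k * a k) *\<^sub>C g k) (\<lambda>s. \<Sum>\<^sub>\<infinity>k. (e s k * a k) *\<^sub>C g k)
      (finite_subsets_at_top UNIV)"
    and bessel_continuous_on: "(\<And>k. continuous_on S (\<lambda>s. e s k)) \<Longrightarrow>
      continuous_on S (\<lambda>s. \<Sum>\<^sub>\<infinity>k. (e s k * a k) *\<^sub>C g k)"
proof -
  have K: "K \<ge> 0" using g by (auto simp: bessel_def)
  have "(norm (\<Sum>k\<in>F. (e s k * a k) *\<^sub>C g k))\<^sup>2 \<le> K * (\<Sum>k\<in>F. (cmod (a k))\<^sup>2 * (v k)\<^sup>2)"
    if s: "s \<in> S" and "finite F" for s F
  proof -
    have "(norm (\<Sum>k\<in>F. (e s k * a k) *\<^sub>C g k))\<^sup>2 \<le> K * (\<Sum>k\<in>F. (cmod (e s k * a k))\<^sup>2 * (v k)\<^sup>2)"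
      using g that by (auto simp: bessel_def)
    also have "\<dots> \<le> K * (\<Sum>k\<in>F. (cmod (a k))\<^sup>2 * (v k)\<^sup>2)"
      using K e[OF s]
      by (intro mult_left_mono sum_mono mult_right_mono power_mono)
        (auto simp: norm_mult mult_left_le_one_le)
    finally show ?thesis .
  qed
  then show ul: "uniform_limit S (\<lambda>F s. \<Sum>k\<in>F. (e s k * a k) *\<^sub>C g k)
      (\<lambda>s. \<Sum>\<^sub>\<infinity>k. (e s k * a k) *\<^sub>C g k) (finite_subsets_at_top UNIV)"
    using K a by (intro uniform_limit_sum_square_bound) (auto simp: sq_summable_def)
  assume "\<And>k. continuous_on S (\<lambda>s. e s k)"
  then show "continuous_on S (\<lambda>s. \<Sum>\<^sub>\<infinity>k. (e s k * a k) *\<^sub>C g k)"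
    by (intro uniform_limit_theorem[OF _ ul] always_eventually allI continuous_intros) auto
qed

section \<open>Riesz bases and their coordinates\<close>

locale riesz_basis_pair =
  fixes \<phi> \<psi> :: "int \<Rightarrow> 'z::complex_hilbert"
  assumes riesz: "riesz_basis \<phi>" and biorth: "biorthogonal \<phi> \<psi>"
begin

lemma cinner_finite_sum:
  "finite F \<Longrightarrow> cinner (\<Sum>n\<in>F. a n *\<^sub>C \<phi> n) (\<psi> m) = (if m \<in> F then a m else 0)"
  using biorth unfolding biorthogonal_def
  by (simp add: cinner_sum_left cinner_scaleC_left if_distrib[of "\<lambda>x. _ * x"] sum.delta cong: if_cong)

lemma ex_synthesis_bound: "\<exists>K. bessel K (\<lambda>_. 1) \<phi>"
  using riesz unfolding riesz_basis_def bessel_def by (auto intro: less_imp_le)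

text \<open>The lower Riesz inequality bounds the coordinates of finite combinations by their norm;
  since each coordinate is continuous, density carries the estimate to every vector.\<close>

lemma ex_analysis_bound:
  "\<exists>K\<ge>0. \<forall>z F. finite F \<longrightarrow> (\<Sum>n\<in>F. (cmod (cinner z (\<psi> n)))\<^sup>2) \<le> K * (norm z)\<^sup>2"
proof -
  obtain m where m: "m > 0"
    and low: "\<And>F a. finite F \<Longrightarrow> m * (\<Sum>n\<in>F. (cmod (a n))\<^sup>2) \<le> (norm (\<Sum>n\<in>F. a n *\<^sub>C \<phi> n))\<^sup>2"
    and dense: "closure {\<Sum>n\<in>F. a n *\<^sub>C \<phi> n | F a. finite F} = UNIV"
    using riesz unfolding riesz_basis_def by blast
  have "(\<Sum>n\<in>F. (cmod (cinner z (\<psi> n)))\<^sup>2) \<le> (1/m) * (norm z)\<^sup>2" if F: "finite F" for z F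
  proof -
    let ?C = "{z. (\<Sum>n\<in>F. (cmod (cinner z (\<psi> n)))\<^sup>2) \<le> (1/m) * (norm z)\<^sup>2}"
    have "closed ?C"
      by (intro closed_Collect_le continuous_intros
          bounded_linear.continuous_on[OF bounded_linear_cinner_left])
    moreover have "{\<Sum>n\<in>F. a n *\<^sub>C \<phi> n | F a. finite F} \<subseteq> ?C"
    proof safe
      fix G :: "int set" and a :: "int \<Rightarrow> complex" assume G: "finite G"
      have "(\<Sum>n\<in>F. (cmod (cinner (\<Sum>n\<in>G. a n *\<^sub>C \<phi> n) (\<psi> n)))\<^sup>2) = (\<Sum>n\<in>F \<inter> G. (cmod (a n))\<^sup>2)"
        using F by (auto simp: cinner_finite_sum[OF G] split: if_splits intro!: sum.mono_neutral_cong_right)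
      also have "\<dots> \<le> (\<Sum>n\<in>G. (cmod (a n))\<^sup>2)" using G by (intro sum_mono2) auto
      also have "\<dots> \<le> (1/m) * (norm (\<Sum>n\<in>G. a n *\<^sub>C \<phi> n))\<^sup>2"
        using low[OF G, of a] m by (simp add: field_simps)
      finally show "(\<Sum>n\<in>F. (cmod (cinner (\<Sum>n\<in>G. a n *\<^sub>C \<phi> n) (\<psi> n)))\<^sup>2)
        \<le> (1/m) * (norm (\<Sum>n\<in>G. a n *\<^sub>C \<phi> n))\<^sup>2" .
    qed
    ultimately have "?C = UNIV" using dense closure_minimal by blast
    then show ?thesis by blast
  qed
  then show ?thesis using m by (intro exI[of _ "1/m"]) auto
qed

lemma sq_summable_cinner: "sq_summable (\<lambda>_. 1) (\<lambda>n. cinner z (\<psi> n))"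
proof -
  obtain K where "\<And>F. finite F \<Longrightarrow> (\<Sum>n\<in>F. (cmod (cinner z (\<psi> n)))\<^sup>2) \<le> K * (norm z)\<^sup>2"
    using ex_analysis_bound by blast
  then show ?thesis unfolding sq_summable_def
    by (intro nonneg_bdd_above_summable_on bdd_aboveI2) auto
qed

lemma cinner_synthesis:
  assumes "sq_summable (\<lambda>_. 1) a"
  shows "cinner (\<Sum>\<^sub>\<infinity>n. a n *\<^sub>C \<phi> n) (\<psi> m) = a m"
proof -
  obtain K where K: "bessel K (\<lambda>_. 1) \<phi>" using ex_synthesis_bound by blast
  have "((\<lambda>n. cinner (a n *\<^sub>C \<phi> n) (\<psi> m)) has_sum cinner (\<Sum>\<^sub>\<infinity>n. a n *\<^sub>C \<phi> n) (\<psi> m)) UNIV"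
    by (rule cinner_has_sum[OF bessel_has_sum[OF K assms]])
  moreover have "((\<lambda>n. cinner (a n *\<^sub>C \<phi> n) (\<psi> m)) has_sum a m) UNIV"
    using biorth unfolding biorthogonal_def
    by (intro has_sum_finite_neutralI[of "{m}"]) (auto simp: cinner_scaleC_left)
  ultimately show ?thesis by (rule has_sum_unique)
qed

text \<open>The diagonal operator with symbol \<open>e\<close>. All bounded functions of the generator, and the
  generator itself on its domain, are of this form.\<close>

definition diag :: "(int \<Rightarrow> complex) \<Rightarrow> 'z \<Rightarrow> 'z" where
  "diag e z = (\<Sum>\<^sub>\<infinity>n. (e n * cinner z (\<psi> n)) *\<^sub>C \<phi> n)"

lemma sq_summable_bounded_symbol:
  assumes "\<And>n. cmod (e n) \<le> N"
  shows "sq_summable (\<lambda>_. 1) (\<lambda>n. e n * cinner z (\<psi> n))"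
  by (rule sq_summable_le[OF sq_summable_cinner[of z], of _ N])
    (auto simp: norm_mult intro: mult_right_mono assms)

lemma cinner_diag:
  assumes "\<And>n. cmod (e n) \<le> N"
  shows "cinner (diag e z) (\<psi> n) = e n * cinner z (\<psi> n)"
  unfolding diag_def by (rule cinner_synthesis[OF sq_summable_bounded_symbol[OF assms]])

lemma ex_diag_bound:
  "\<exists>K>0. \<forall>e N z. (\<forall>n. cmod (e n) \<le> N) \<longrightarrow> norm (diag e z) \<le> K * N * norm z"
proof -
  obtain K where K: "bessel K (\<lambda>_. 1) \<phi>" using ex_synthesis_bound by blast
  have K0: "K \<ge> 0" using K by (simp add: bessel_def)
  obtain J where J: "J \<ge> 0"
    "\<And>z F. finite F \<Longrightarrow> (\<Sum>n\<in>F. (cmod (cinner z (\<psi> n)))\<^sup>2) \<le> J * (norm z)\<^sup>2"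
    using ex_analysis_bound by blast
  define R where "R = sqrt (K * J) + 1"
  have R: "R > 0" using K0 J by (simp add: R_def add_nonneg_pos)
  have "norm (diag e z) \<le> R * N * norm z" if e: "\<And>n. cmod (e n) \<le> N" for e N z
  proof -
    have N: "N \<ge> 0" using e[of 0] norm_ge_zero order_trans by blast
    have "(\<Sum>\<^sub>\<infinity>n. (cmod (e n * cinner z (\<psi> n)))\<^sup>2 * 1\<^sup>2) \<le> J * (N * norm z)\<^sup>2"
    proof (rule infsum_le_finite_sums)
      show "(\<lambda>n. (cmod (e n * cinner z (\<psi> n)))\<^sup>2 * 1\<^sup>2) summable_on UNIV"
        using sq_summable_bounded_symbol[OF e] unfolding sq_summable_def .
      fix F :: "int set" assume F: "finite F"
      have "(\<Sum>n\<in>F. (cmod (e n * cinner z (\<psi> n)))\<^sup>2 * 1\<^sup>2)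
          \<le> (\<Sum>n\<in>F. N\<^sup>2 * (cmod (cinner z (\<psi> n)))\<^sup>2)"
        using e by (intro sum_mono) (auto simp: norm_mult power_mult_distrib intro!: mult_right_mono power_mono)
      also have "\<dots> \<le> N\<^sup>2 * (J * (norm z)\<^sup>2)"
        unfolding sum_distrib_left[symmetric] using J(2)[OF F] by (intro mult_left_mono) auto
      finally show "(\<Sum>n\<in>F. (cmod (e n * cinner z (\<psi> n)))\<^sup>2 * 1\<^sup>2) \<le> J * (N * norm z)\<^sup>2"
        by (simp add: power_mult_distrib mult_ac)
    qed
    then have "K * (\<Sum>\<^sub>\<infinity>n. (cmod (e n * cinner z (\<psi> n)))\<^sup>2 * 1\<^sup>2) \<le> K * (J * (N * norm z)\<^sup>2)"
      using K0 by (rule mult_left_mono)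
    then have "(norm (diag e z))\<^sup>2 \<le> K * (J * (N * norm z)\<^sup>2)"
      using bessel_norm[OF K sq_summable_bounded_symbol[where e = e and z = z, OF e]] unfolding diag_def by linarith
    also have "\<dots> = (sqrt (K * J) * (N * norm z))\<^sup>2"
      using K0 J by (simp add: power_mult_distrib)
    finally have "norm (diag e z) \<le> sqrt (K * J) * (N * norm z)"
      by (rule power2_le_imp_le) (use K0 J N in simp)
    also have "\<dots> \<le> R * (N * norm z)"
      using N by (intro mult_right_mono) (auto simp: R_def)
    finally show ?thesis by (simp add: mult.assoc)
  qed
  then show ?thesis using R by blast
qed

text \<open>The vector rebuilt from the coordinates of \<open>z\<close> depends continuously on \<open>z\<close> and equals \<open>z\<close> on
  the dense set of finite combinations.\<close>

lemma diag_one: "diag (\<lambda>_. 1) z = z"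
proof -
  obtain K where K: "\<And>e N z. (\<And>n. cmod (e n) \<le> N) \<Longrightarrow> norm (diag e z) \<le> K * N * norm z"
    using ex_diag_bound by blast
  have add: "diag (\<lambda>_. 1) (x - y) = diag (\<lambda>_. 1) x - diag (\<lambda>_. 1) y" for x y
  proof -
    obtain B where B: "bessel B (\<lambda>_. 1) \<phi>" using ex_synthesis_bound by blast
    have s: "((\<lambda>n. (1 * cinner x (\<psi> n)) *\<^sub>C \<phi> n) has_sum diag (\<lambda>_. 1) x) UNIV" for x
      unfolding diag_def by (rule bessel_has_sum[OF B sq_summable_bounded_symbol[of _ 1]]) simp
    have "((\<lambda>n. (1 * cinner x (\<psi> n)) *\<^sub>C \<phi> n + - ((1 * cinner y (\<psi> n)) *\<^sub>C \<phi> n))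
        has_sum (diag (\<lambda>_. 1) x + - diag (\<lambda>_. 1) y)) UNIV"
      by (intro has_sum_add s has_sum_uminus[THEN iffD2]) (simp only: minus_minus s)
    then show ?thesis
      using has_sum_unique s[of "x - y"] by (force simp: cinner_diff_left scaleC_diff_left)
  qed
  have cont: "continuous_on UNIV (diag (\<lambda>_. 1))"
  proof (rule lipschitz_on_continuous_on[of "max 0 K"], rule lipschitz_onI)
    fix x y :: 'z
    have "dist (diag (\<lambda>_. 1) x) (diag (\<lambda>_. 1) y) \<le> K * 1 * norm (x - y)"
      unfolding dist_norm add[symmetric] by (rule K) simp
    also have "\<dots> \<le> max 0 K * dist x y" by (simp add: dist_norm mult_right_mono)
    finally show "dist (diag (\<lambda>_. 1) x) (diag (\<lambda>_. 1) y) \<le> max 0 K * dist x y" .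
  qed simp
  let ?S = "{\<Sum>n\<in>F. a n *\<^sub>C \<phi> n | F a. finite F}"
  have "?S \<subseteq> {z. diag (\<lambda>_. 1) z = z}"
  proof safe
    fix F :: "int set" and a :: "int \<Rightarrow> complex" assume F: "finite F"
    have "((\<lambda>n. (1 * cinner (\<Sum>n\<in>F. a n *\<^sub>C \<phi> n) (\<psi> n)) *\<^sub>C \<phi> n) has_sum (\<Sum>n\<in>F. a n *\<^sub>C \<phi> n)) UNIV"
      using F by (intro has_sum_finite_neutralI[of F]) (auto simp: cinner_finite_sum)
    then show "diag (\<lambda>_. 1) (\<Sum>n\<in>F. a n *\<^sub>C \<phi> n) = (\<Sum>n\<in>F. a n *\<^sub>C \<phi> n)"
      unfolding diag_def by (rule infsumI)
  qed
  moreover have "closed {z. diag (\<lambda>_. 1) z = z}"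
    by (intro closed_Collect_eq cont continuous_intros)
  ultimately have "closure ?S \<subseteq> {z. diag (\<lambda>_. 1) z = z}" by (rule closure_minimal)
  moreover have "closure ?S = UNIV" using riesz unfolding riesz_basis_def by blast
  ultimately show ?thesis by blast
qed

lemma eq_by_coordinates:
  assumes "\<And>n. cinner x (\<psi> n) = cinner y (\<psi> n)"
  shows "x = y"
proof -
  have "diag (\<lambda>_. 1) x = diag (\<lambda>_. 1) y" by (simp add: diag_def assms)
  then show ?thesis by (simp add: diag_one)
qed

lemma expansion: "((\<lambda>n. cinner z (\<psi> n) *\<^sub>C \<phi> n) has_sum z) UNIV"
proof -
  obtain B where "bessel B (\<lambda>_. 1) \<phi>" using ex_synthesis_bound by blast
  from bessel_has_sum[OF this sq_summable_cinner[of z]] show ?thesis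
    using diag_one[of z] by (simp add: diag_def)
qed

lemma spectral_dom_iff:
  "z \<in> spectral_dom \<mu> \<psi> \<longleftrightarrow> sq_summable (\<lambda>_. 1) (\<lambda>n. \<mu> n * cinner z (\<psi> n))"
  by (simp add: spectral_dom_def sq_summable_def norm_mult power_mult_distrib)

lemma cinner_spectral_op:
  "z \<in> spectral_dom \<mu> \<psi> \<Longrightarrow> cinner (spectral_op \<mu> \<phi> \<psi> z) (\<psi> n) = \<mu> n * cinner z (\<psi> n)"
  unfolding spectral_dom_iff spectral_op_def by (rule cinner_synthesis)

lemma basis_in_spectral_dom: "\<phi> n \<in> spectral_dom \<mu> \<psi>"
  using biorth unfolding biorthogonal_def spectral_dom_def
  by (auto intro!: finite_nonzero_values_imp_summable_on finite_subset[of _ "{n}"] split: if_splits)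

lemma spectral_op_basis: "spectral_op \<mu> \<phi> \<psi> (\<phi> n) = \<mu> n *\<^sub>C \<phi> n"
  by (rule eq_by_coordinates, subst cinner_spectral_op[OF basis_in_spectral_dom])
    (use biorth in \<open>auto simp: biorthogonal_def cinner_scaleC_left\<close>)

end

section \<open>Local boundedness of strongly continuous semigroups\<close>

text \<open>The principle of uniform boundedness, by Baire category: one of the closed sets on which the
  family is bounded by \<open>k\<close> contains a ball, and translating the ball to the origin costs a
  factor two.\<close>

lemma uniform_boundedness:
  fixes F :: "nat \<Rightarrow> 'a::banach \<Rightarrow> 'b::real_normed_vector"
  assumes F: "\<And>n. bounded_linear (F n)" and pw: "\<And>x. \<exists>c. \<forall>n. norm (F n x) \<le> c"
  shows "\<exists>M. \<forall>n x. norm (F n x) \<le> M * norm x"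
proof -
  define E where "E k = {x. \<forall>n. norm (F n x) \<le> real k}" for k :: nat
  have cl: "closed (E k)" for k
    unfolding E_def
    by (intro closed_Collect_all closed_Collect_le continuous_intros bounded_linear.continuous_on[OF F])
  have "\<exists>k. interior (E k) \<noteq> {}"
  proof (rule ccontr)
    assume "\<not> ?thesis"
    then have "euclidean interior_of \<Union> (range E) = {}"
      using cl by (intro Baire_category_alt) (auto simp: completely_metrizable_space_euclidean)
    moreover have "\<Union> (range E) = UNIV"
    proof safe
      fix x obtain c where "\<forall>n. norm (F n x) \<le> c" using pw by blast
      then have "x \<in> E (nat \<lceil>c\<rceil>)" unfolding E_def by (auto intro: order_trans real_nat_ceiling_ge)
      then show "x \<in> \<Union> (range E)" by blast
    qed auto
    ultimately show False by simp
  qed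
  then obtain k x0 r where r: "r > 0" "cball x0 r \<subseteq> E k"
    by (metis all_not_in_conv mem_interior_cball)
  have "norm (F n x) \<le> (2 * real k / r) * norm x" for n x
  proof (cases "x = 0")
    case True
    then show ?thesis using F[of n] by (simp add: bounded_linear.linear linear_0)
  next
    case False
    interpret bounded_linear "F n" by (rule F)
    define y where "y = (r / norm x) *\<^sub>R x"
    have y: "norm y = r" using False r by (simp add: y_def)
    have "x0 + y \<in> E k" "x0 \<in> E k" using r y by (auto simp: dist_norm)
    then have "norm (F n (x0 + y)) \<le> real k" "norm (F n x0) \<le> real k" by (auto simp: E_def)
    moreover have "F n y = F n (x0 + y) - F n x0" by (simp add: add)
    ultimately have "norm (F n y) \<le> 2 * real k"
      using norm_triangle_ineq4[of "F n (x0 + y)" "F n x0"] by simp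
    moreover have "norm (F n y) = r / norm x * norm (F n x)"
      using r by (simp add: y_def scaleR)
    ultimately show ?thesis using r False by (simp add: field_simps)
  qed
  then show ?thesis by blast
qed

lemma c0_semigroup_tendsto_0:
  assumes T: "c0_semigroup T" and s: "\<And>n. s n \<ge> 0" "s \<longlonglongrightarrow> 0"
  shows "(\<lambda>n. T (s n) z) \<longlonglongrightarrow> z"
proof -
  have T0: "T 0 z = z" and lim: "((\<lambda>t. T t z) \<longlongrightarrow> z) (at_right 0)"
    using T by (auto simp: c0_semigroup_def)
  have "((\<lambda>t. T t z) \<longlongrightarrow> T 0 z) (at 0 within {0..})"
    using lim by (simp add: T0 at_within_Ici_at_right)
  then have "continuous (at 0 within {0..}) (\<lambda>t. T t z)"
    by (simp add: continuous_within)
  from continuous_within_tendsto_compose'[OF this, of s sequentially] s show ?thesis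
    by (simp add: T0)
qed

text \<open>Operators \<open>T(s)\<close> of unbounded norm at times \<open>s \<rightarrow> 0\<close> would contradict uniform boundedness, since
  \<open>T(s) z\<close> converges for every \<open>z\<close>; the semigroup law carries the bound to longer intervals.\<close>

lemma c0_semigroup_locally_bounded:
  assumes T: "c0_semigroup T"
  shows "\<exists>M. \<forall>s\<in>{0..t}. \<forall>z. norm (T s z) \<le> M * norm z"
proof -
  have bl: "bounded_linear (T s)" if "s \<ge> 0" for s
    using T that by (auto simp: c0_semigroup_def bounded_clinear_def)
  have "\<exists>n::nat. \<forall>s\<in>{0..inverse (real (Suc n))}. \<forall>z. norm (T s z) \<le> real n * norm z"
  proof (rule ccontr)
    assume "\<not> ?thesis"
    then have "\<forall>n. \<exists>s z. s \<in> {0..inverse (real (Suc n))} \<and> \<not> norm (T s z) \<le> real n * norm z" by blast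
    then obtain s z where s: "\<And>n. s n \<in> {0..inverse (real (Suc n))}"
      and z: "\<And>n. \<not> norm (T (s n) (z n)) \<le> real n * norm (z n)" by metis
    have "s \<longlonglongrightarrow> 0"
      by (rule real_tendsto_sandwich[OF _ _ tendsto_const LIMSEQ_inverse_real_of_nat])
        (use s in \<open>auto simp del: of_nat_Suc\<close>)
    then have conv: "(\<lambda>n. T (s n) x) \<longlonglongrightarrow> x" for x
      using c0_semigroup_tendsto_0[OF T] s by auto
    have "\<exists>M. \<forall>n x. norm (T (s n) x) \<le> M * norm x"
    proof (rule uniform_boundedness)
      show "bounded_linear (T (s n))" for n using s bl by auto
      show "\<exists>c. \<forall>n. norm (T (s n) x) \<le> c" for x
        using convergent_imp_Bseq[OF convergentI[OF conv[of x]]] unfolding Bseq_def by blast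
    qed
    then obtain M where M: "\<And>n x. norm (T (s n) x) \<le> M * norm x" by blast
    have "norm (T (s (nat \<lceil>M\<rceil>)) (z (nat \<lceil>M\<rceil>))) \<le> real (nat \<lceil>M\<rceil>) * norm (z (nat \<lceil>M\<rceil>))"
      by (rule order_trans[OF M]) (intro mult_right_mono real_nat_ceiling_ge norm_ge_zero)
    then show False using z by blast
  qed
  then obtain n :: nat
    where n: "\<And>s z. s \<in> {0..inverse (real (Suc n))} \<Longrightarrow> norm (T s z) \<le> real n * norm z" by blast
  define h where "h = inverse (real (Suc n))"
  have h: "h > 0" by (simp add: h_def)
  have "\<forall>s\<in>{0..real j * h}. \<forall>z. norm (T s z) \<le> (real n + 1) ^ j * norm z" for j
  proof (induction j)
    case 0
    then show ?case using T by (auto simp: c0_semigroup_def)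
  next
    case (Suc j)
    show ?case
    proof (intro ballI allI)
      fix s z assume s: "s \<in> {0..real (Suc j) * h}"
      have small: "norm (T u z) \<le> (real n + 1) * norm z" if "u \<in> {0..h}" for u z
        by (rule order_trans[OF n]) (use that h_def in \<open>auto intro: mult_right_mono\<close>)
      define u where "u = min s h"
      have u: "u \<in> {0..h}" "s - u \<in> {0..real j * h}"
        using s h by (auto simp: u_def min_def algebra_simps)
      have "T s z = T (s - u) (T u z)"
        using T u unfolding c0_semigroup_def by (metis atLeastAtMost_iff diff_add_cancel)
      then have "norm (T s z) \<le> (real n + 1) ^ j * norm (T u z)" using Suc u by auto
      also have "\<dots> \<le> (real n + 1) ^ j * ((real n + 1) * norm z)"
        using small[OF u(1)] by (intro mult_left_mono) auto
      finally show "norm (T s z) \<le> (real n + 1) ^ Suc j * norm z" by (simp add: mult_ac)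
    qed
  qed
  moreover obtain j :: nat where "t < real j * h" using h reals_Archimedean3 by blast
  ultimately show ?thesis by (intro exI[of _ "(real n + 1) ^ j"]) auto
qed

lemma exp_difference_quotient:
  fixes m :: complex
  shows "((\<lambda>h::real. (exp (m * complex_of_real h) - 1) / complex_of_real h) \<longlongrightarrow> m) (at_right 0)"
proof -
  have "((\<lambda>z. exp (m * z)) has_field_derivative m) (at 0)"
    by (auto intro!: derivative_eq_intros)
  from DERIV_D[OF this] have 1: "((\<lambda>h. (exp (m * h) - 1) / h) \<longlongrightarrow> m) (at 0)" by simp
  have "filterlim complex_of_real (at 0) (at_right 0)"
    unfolding filterlim_at by (auto intro!: tendsto_eq_intros simp: eventually_at_filter)
  from filterlim_compose[OF 1 this] show ?thesis .
qed

text \<open>An eigenvector of the generator evolves by the scalar exponential. The error over time \<open>t\<close> is a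
  telescoping sum of \<open>N\<close> copies of the one-step error at step \<open>t/N\<close>, each transported by operators
  that are bounded on \<open>[0, t]\<close>; the generator makes the one-step error \<open>o(t/N)\<close>. Local boundedness
  is essential here, since a right derivative alone does not control jumps from the left.\<close>

lemma semigroup_eigenvector:
  fixes T :: "real \<Rightarrow> 'z::complex_hilbert \<Rightarrow> 'z"
  assumes T: "c0_semigroup T" and gen: "is_generator D A T"
    and x: "x \<in> D" "A x = m *\<^sub>C x" and m: "Re m \<le> 0" and t: "t \<ge> 0"
  shows "T t x = exp (m * complex_of_real t) *\<^sub>C x"
proof -
  obtain K where K: "\<And>s z. s \<in> {0..t} \<Longrightarrow> norm (T s z) \<le> K * norm z"
    using c0_semigroup_locally_bounded[OF T] by blast
  define r where "r h = T h x - exp (m * complex_of_real h) *\<^sub>C x" for h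
  have Tr: "bounded_clinear (T s)" if "s \<ge> 0" for s using T that by (auto simp: c0_semigroup_def)
  have step: "norm (T (real j * h) x - exp (m * complex_of_real (real j * h)) *\<^sub>C x)
      \<le> real j * (K * norm (r h))" if h: "h \<ge> 0" "real j * h \<le> t" for j h
    using h(2)
  proof (induction j)
    case 0
    then show ?case using T by (simp add: c0_semigroup_def)
  next
    case (Suc j)
    have jh: "real j * h \<le> t" using Suc.prems h(1) by (simp add: algebra_simps)
    let ?e = "\<lambda>s. exp (m * complex_of_real s)"
    have "real (Suc j) * h = real j * h + h" by (simp add: algebra_simps)
    then have "T (real (Suc j) * h) x = T (real j * h) (T h x)"
      using T h(1) by (simp add: c0_semigroup_def)
    moreover have "?e (real (Suc j) * h) = ?e h * ?e (real j * h)"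
      by (simp add: exp_add[symmetric] algebra_simps)
    ultimately have "T (real (Suc j) * h) x - ?e (real (Suc j) * h) *\<^sub>C x
        = T (real j * h) (r h) + ?e h *\<^sub>C (T (real j * h) x - ?e (real j * h) *\<^sub>C x)"
      using h by (simp add: r_def bounded_clinearD[OF Tr] scaleC_scaleC scaleC_diff_right)
    also have "norm \<dots> \<le> K * norm (r h) + 1 * (real j * (K * norm (r h)))"
    proof (rule norm_triangle_mono)
      show "norm (T (real j * h) (r h)) \<le> K * norm (r h)" using jh h by (intro K) auto
      have "cmod (?e h) \<le> 1" using m h by (simp add: mult_nonpos_nonneg)
      then show "norm (?e h *\<^sub>C (T (real j * h) x - ?e (real j * h) *\<^sub>C x))
          \<le> 1 * (real j * (K * norm (r h)))"
        unfolding norm_scaleC using Suc.IH[OF jh] by (intro mult_mono) auto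
    qed
    finally show ?case by (simp add: algebra_simps)
  qed
  have "((\<lambda>h. (T h x - x) /\<^sub>R h) \<longlongrightarrow> m *\<^sub>C x) (at_right 0)"
    using gen x unfolding is_generator_def by auto
  moreover have "((\<lambda>h. ((exp (m * complex_of_real h) - 1) / complex_of_real h) *\<^sub>C x) \<longlongrightarrow> m *\<^sub>C x) (at_right 0)"
    by (rule bounded_linear.tendsto[OF bounded_linear_scaleC_left exp_difference_quotient])
  ultimately have "((\<lambda>h. (T h x - x) /\<^sub>R h - ((exp (m * complex_of_real h) - 1) / complex_of_real h) *\<^sub>C x)
      \<longlongrightarrow> m *\<^sub>C x - m *\<^sub>C x) (at_right 0)" by (rule tendsto_diff)
  moreover have "(T h x - x) /\<^sub>R h - ((exp (m * complex_of_real h) - 1) / complex_of_real h) *\<^sub>C x = r h /\<^sub>R h" for h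
    by (simp add: r_def scaleR_scaleC scaleC_scaleC scaleC_diff_left scaleC_diff_right divide_inverse
        algebra_simps)
  ultimately have "((\<lambda>h. r h /\<^sub>R h) \<longlongrightarrow> 0) (at_right 0)" by simp
  then have lim: "((\<lambda>h. norm (r h) / h) \<longlongrightarrow> 0) (at_right 0)"
    by (intro Lim_transform_eventually[OF tendsto_norm_zero])
      (auto simp: eventually_at_filter divide_inverse mult.commute)
  show ?thesis
  proof (cases "t = 0")
    case True
    then show ?thesis using T by (simp add: c0_semigroup_def)
  next
    case False
    with t have t: "t > 0" by simp
    have "filterlim (\<lambda>N. t * inverse (real (Suc N))) (at_right 0) sequentially"
      unfolding filterlim_at
      using t tendsto_mult_right_zero[OF LIMSEQ_inverse_real_of_nat, of t] by auto
    from filterlim_compose[OF lim this]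
    have "(\<lambda>N. (t * K) * (norm (r (t * inverse (real (Suc N)))) / (t * inverse (real (Suc N))))) \<longlonglongrightarrow> (t * K) * 0"
      by (intro tendsto_mult_left)
    moreover have "norm (T t x - exp (m * complex_of_real t) *\<^sub>C x)
        \<le> (t * K) * (norm (r (t * inverse (real (Suc N)))) / (t * inverse (real (Suc N))))" for N
    proof -
      let ?h = "t * inverse (real (Suc N))"
      have eq: "real (Suc N) * ?h = t" by (simp del: of_nat_Suc)
      have "norm (T t x - exp (m * complex_of_real t) *\<^sub>C x) \<le> real (Suc N) * (K * norm (r ?h))"
        using step[of ?h "Suc N"] t unfolding eq by simp
      also have "\<dots> = (t * K) * (norm (r ?h) / ?h)"
        using t by (simp add: divide_inverse mult_ac del: of_nat_Suc)
      finally show ?thesis .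
    qed
    ultimately have "norm (T t x - exp (m * complex_of_real t) *\<^sub>C x) \<le> t * K * 0"
      by (intro tendsto_lowerbound[of _ _ sequentially]) auto
    then show ?thesis by simp
  qed
qed

section \<open>Semigroups with a diagonal generator\<close>

lemma exp_tendsto_0:
  assumes "Re m < 0"
  shows "((\<lambda>t. exp (m * complex_of_real t)) \<longlongrightarrow> 0) at_top"
proof -
  have "filterlim (\<lambda>t. Re m * t) at_bot at_top"
    using assms by (intro filterlim_tendsto_neg_mult_at_bot[OF tendsto_const]) (auto simp: filterlim_ident)
  then have "((\<lambda>t. exp (Re m * t)) \<longlongrightarrow> 0) at_top"
    by (rule filterlim_compose[OF exp_at_bot])
  then show ?thesis by (intro tendsto_norm_zero_cancel[of "\<lambda>t. exp (m * complex_of_real t)"]) simp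
qed

locale diagonal_semigroup = riesz_basis_pair \<phi> \<psi>
  for \<phi> \<psi> :: "int \<Rightarrow> 'z::complex_hilbert" +
  fixes \<mu> :: "int \<Rightarrow> complex" and T :: "real \<Rightarrow> 'z \<Rightarrow> 'z"
  assumes Re_neg: "Re (\<mu> n) < 0"
    and no_limit: "\<not> (\<i> * complex_of_real x) islimpt range \<mu>"
    and c0: "c0_semigroup T"
    and gen: "is_generator (spectral_dom \<mu> \<psi>) (spectral_op \<mu> \<phi> \<psi>) T"
begin

lemma diag_diag:
  assumes "\<And>n. cmod (e n) \<le> N"
  shows "diag g (diag e z) = diag (\<lambda>n. g n * e n) z"
  by (simp only: diag_def[of g] diag_def[of "\<lambda>n. g n * e n"] cinner_diag[OF assms] mult.assoc)

lemma T_clinear: "t \<ge> 0 \<Longrightarrow> bounded_clinear (T t)"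
  using c0 by (simp add: c0_semigroup_def)

lemma T_basis: "t \<ge> 0 \<Longrightarrow> T t (\<phi> n) = exp (\<mu> n * complex_of_real t) *\<^sub>C \<phi> n"
  using semigroup_eigenvector[OF c0 gen basis_in_spectral_dom spectral_op_basis] Re_neg
  by (auto intro: less_imp_le)

lemma cinner_T:
  assumes "t \<ge> 0"
  shows "cinner (T t z) (\<psi> n) = exp (\<mu> n * complex_of_real t) * cinner z (\<psi> n)"
proof -
  have "((\<lambda>k. cinner (T t (cinner z (\<psi> k) *\<^sub>C \<phi> k)) (\<psi> n)) has_sum cinner (T t z) (\<psi> n)) UNIV"
    by (intro cinner_has_sum has_sum_bounded_linear[OF _ expansion] bounded_clinearD T_clinear assms)
  moreover have "((\<lambda>k. cinner (T t (cinner z (\<psi> k) *\<^sub>C \<phi> k)) (\<psi> n))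
      has_sum exp (\<mu> n * complex_of_real t) * cinner z (\<psi> n)) UNIV"
    using biorth unfolding biorthogonal_def
    by (intro has_sum_finite_neutralI[of "{n}"])
      (auto simp: bounded_clinearD(2)[OF T_clinear[OF assms]] T_basis[OF assms] cinner_scaleC_left)
  ultimately show ?thesis by (rule has_sum_unique)
qed

lemma cmod_exp_le_1: "t \<ge> 0 \<Longrightarrow> Re s \<ge> 0 \<Longrightarrow> cmod (exp ((\<mu> n - s) * complex_of_real t)) \<le> 1"
  using Re_neg[of n] by (simp add: mult_nonpos_nonneg)

text \<open>The twisted orbits \<open>e\<^sup>-\<^sup>s\<^sup>t T(t) z\<close> are the ones that occur in Laplace transforms of the semigroup
  on the closed right half-plane.\<close>

lemma twisted_orbit:
  assumes "t \<ge> 0" "Re s \<ge> 0"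
  shows "exp (- s * complex_of_real t) *\<^sub>C T t z = diag (\<lambda>n. exp ((\<mu> n - s) * complex_of_real t)) z"
proof (rule eq_by_coordinates)
  fix n
  have "exp ((\<mu> n - s) * complex_of_real t) = exp (- s * complex_of_real t) * exp (\<mu> n * complex_of_real t)"
    by (simp add: exp_add[symmetric] algebra_simps)
  then show "cinner (exp (- s * complex_of_real t) *\<^sub>C T t z) (\<psi> n)
      = cinner (diag (\<lambda>n. exp ((\<mu> n - s) * complex_of_real t)) z) (\<psi> n)"
    using assms by (subst cinner_diag[OF cmod_exp_le_1]) (auto simp: cinner_scaleC_left cinner_T)
qed

lemma T_diag: "t \<ge> 0 \<Longrightarrow> T t z = diag (\<lambda>n. exp (\<mu> n * complex_of_real t)) z"
  using twisted_orbit[of t 0 z] by simp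

lemma continuous_on_twisted_orbit:
  assumes "Re s \<ge> 0"
  shows "continuous_on {0..} (\<lambda>t. exp (- s * complex_of_real t) *\<^sub>C T t z)"
proof -
  obtain K where K: "bessel K (\<lambda>_. 1) \<phi>" using ex_synthesis_bound by blast
  have "continuous_on {0..} (\<lambda>t. diag (\<lambda>n. exp ((\<mu> n - s) * complex_of_real t)) z)"
    unfolding diag_def
    by (rule bessel_continuous_on[OF K sq_summable_cinner])
      (use assms in \<open>auto intro!: cmod_exp_le_1 continuous_intros simp del: norm_exp_eq_Re\<close>)
  then show ?thesis
    by (rule continuous_on_eq) (simp only: atLeast_iff twisted_orbit[OF _ assms])
qed

lemma ex_T_bound: "\<exists>M>0. \<forall>t\<ge>0. \<forall>z. norm (T t z) \<le> M * norm z"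
proof -
  obtain K where K: "K > 0" "\<And>e N z. (\<And>n. cmod (e n) \<le> N) \<Longrightarrow> norm (diag e z) \<le> K * N * norm z"
    using ex_diag_bound by blast
  have "norm (T t z) \<le> K * norm z" if "t \<ge> 0" for t z
    using K(2)[of "\<lambda>n. exp (\<mu> n * complex_of_real t)" 1 z] cmod_exp_le_1[OF that, of 0]
    by (simp add: T_diag[OF that])
  then show ?thesis using K(1) by blast
qed

text \<open>Strong stability: each coordinate decays and the tail of the expansion is small uniformly in
  time, so the two limits may be interchanged.\<close>

lemma T_tendsto_0: "((\<lambda>t. T t z) \<longlongrightarrow> 0) at_top"
proof -
  obtain K where K: "bessel K (\<lambda>_. 1) \<phi>" using ex_synthesis_bound by blast
  let ?f = "\<lambda>F t. \<Sum>n\<in>F. (exp (\<mu> n * complex_of_real t) * cinner z (\<psi> n)) *\<^sub>C \<phi> n"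
  have "((\<lambda>t. diag (\<lambda>n. exp (\<mu> n * complex_of_real t)) z) \<longlongrightarrow> 0) at_top"
  proof (rule swap_uniform_limit')
    show "uniform_limit {0..} ?f (\<lambda>t. diag (\<lambda>n. exp (\<mu> n * complex_of_real t)) z)
        (finite_subsets_at_top UNIV)"
      unfolding diag_def
      by (rule bessel_uniform_limit[OF K sq_summable_cinner]) (use cmod_exp_le_1[of _ 0] in auto)
    have "((\<lambda>t. exp (\<mu> n * complex_of_real t)) \<longlongrightarrow> 0) at_top" for n
      by (rule exp_tendsto_0[OF Re_neg])
    then have "(?f F \<longlongrightarrow> (\<Sum>n\<in>F. (0 * cinner z (\<psi> n)) *\<^sub>C \<phi> n)) at_top" for F
      by (intro tendsto_sum bounded_linear.tendsto[OF bounded_linear_scaleC_left] tendsto_mult tendsto_const)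
    then show "\<forall>\<^sub>F F in finite_subsets_at_top UNIV. (?f F \<longlongrightarrow> (\<Sum>n\<in>F. (0 * cinner z (\<psi> n)) *\<^sub>C \<phi> n)) at_top"
      by simp
    show "\<forall>\<^sub>F t in at_top. t \<in> {0::real..}" using eventually_ge_at_top[of 0] by simp
  qed auto
  moreover have "\<forall>\<^sub>F t in at_top. diag (\<lambda>n. exp (\<mu> n * complex_of_real t)) z = T t z"
    using eventually_ge_at_top[of 0] by eventually_elim (simp add: T_diag)
  ultimately show ?thesis by (rule Lim_transform_eventually)
qed

lemma spectrum_off_imaginary_axis: "\<i> * complex_of_real x \<notin> closure (range \<mu>)"
proof
  assume "\<i> * complex_of_real x \<in> closure (range \<mu>)"
  then obtain n where "\<mu> n = \<i> * complex_of_real x"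
    using no_limit[of x] unfolding closure_def by (metis UnE mem_Collect_eq rangeE)
  then show False using Re_neg[of n] by simp
qed

lemma spectral_gap: "\<exists>\<delta>>0. \<forall>n. \<delta> \<le> cmod (\<i> * complex_of_real x - \<mu> n)"
proof -
  have "open (- closure (range \<mu>))" by (intro open_Compl closed_closure)
  with spectrum_off_imaginary_axis[of x]
  obtain \<delta> where "\<delta> > 0" "ball (\<i> * complex_of_real x) \<delta> \<subseteq> - closure (range \<mu>)"
    by (meson ComplI open_contains_ball)
  then have "\<delta> \<le> cmod (\<i> * complex_of_real x - \<mu> n)" for n
    using closure_subset[of "range \<mu>"] by (force simp: dist_norm not_less[symmetric])
  then show ?thesis using \<open>\<delta> > 0\<close> by blast
qed

lemma imaginary_minus_eigenvalue_nz: "\<i> * complex_of_real x - \<mu> n \<noteq> 0"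
  using spectral_gap[of x] by (metis norm_zero not_less)

text \<open>The imaginary axis lies in the resolvent set: division by \<open>i x - \<mu>\<^sub>n\<close> is a bounded symbol by the
  spectral gap, and it maps into the domain because
  \<open>\<mu>\<^sub>n / (i x - \<mu>\<^sub>n) = i x / (i x - \<mu>\<^sub>n) - 1\<close> is bounded too.\<close>

lemma cinner_resolvent:
  "cinner (resolvent (spectral_dom \<mu> \<psi>) (spectral_op \<mu> \<phi> \<psi>) (\<i> * complex_of_real x) v) (\<psi> n)
    = cinner v (\<psi> n) / (\<i> * complex_of_real x - \<mu> n)"
proof -
  let ?s = "\<i> * complex_of_real x" and ?D = "spectral_dom \<mu> \<psi>" and ?A = "spectral_op \<mu> \<phi> \<psi>"
  obtain \<delta> where \<delta>: "\<delta> > 0" "\<And>n. \<delta> \<le> cmod (?s - \<mu> n)" using spectral_gap[of x] by blast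
  have nz: "?s - \<mu> n \<noteq> 0" for n by (rule imaginary_minus_eigenvalue_nz)
  define y where "y = diag (\<lambda>n. 1 / (?s - \<mu> n)) v"
  have b: "cmod (1 / (?s - \<mu> n)) \<le> 1 / \<delta>" for n
    using \<delta>(2)[of n] \<delta>(1) by (simp add: norm_divide frac_le)
  have y: "cinner y (\<psi> n) = cinner v (\<psi> n) / (?s - \<mu> n)" for n
    unfolding y_def by (subst cinner_diag[OF b]) simp
  have "sq_summable (\<lambda>_. 1) (\<lambda>n. \<mu> n * cinner y (\<psi> n))"
  proof -
    have eq: "\<mu> n * cinner y (\<psi> n) = (?s * (1 / (?s - \<mu> n)) - 1) * cinner v (\<psi> n)" for n
      using nz[of n] by (simp add: y field_simps)
    have "cmod (?s * (1 / (?s - \<mu> n)) - 1) \<le> \<bar>x\<bar> * (1 / \<delta>) + 1" for n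
    proof -
      have "cmod (?s * (1 / (?s - \<mu> n)) - 1) \<le> cmod ?s * cmod (1 / (?s - \<mu> n)) + 1"
        by (metis norm_mult norm_one norm_triangle_ineq4)
      also have "\<dots> \<le> \<bar>x\<bar> * (1 / \<delta>) + 1"
        using b[of n] by (intro add_right_mono mult_mono) (auto simp: norm_mult)
      finally show ?thesis .
    qed
    then show ?thesis unfolding eq by (rule sq_summable_bounded_symbol)
  qed
  then have yD: "y \<in> ?D" by (simp add: spectral_dom_iff)
  have eq: "cinner (?s *\<^sub>C u - ?A u) (\<psi> n) = (?s - \<mu> n) * cinner u (\<psi> n)" if "u \<in> ?D" for u n
    using that by (simp add: cinner_diff_left cinner_scaleC_left cinner_spectral_op algebra_simps)
  have yv: "?s *\<^sub>C y - ?A y = v"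
    by (rule eq_by_coordinates) (use nz in \<open>simp add: eq[OF yD] y\<close>)
  have "inj_on (\<lambda>u. ?s *\<^sub>C u - ?A u) ?D"
  proof (rule inj_onI)
    fix u w assume uw: "u \<in> ?D" "w \<in> ?D" "?s *\<^sub>C u - ?A u = ?s *\<^sub>C w - ?A w"
    then have "(?s - \<mu> n) * cinner u (\<psi> n) = (?s - \<mu> n) * cinner w (\<psi> n)" for n
      by (metis eq)
    then show "u = w" using nz by (intro eq_by_coordinates) simp
  qed
  then have "resolvent ?D ?A ?s v = y"
    unfolding resolvent_def using yD yv by (intro the_inv_into_f_eq) auto
  then show ?thesis by (simp add: y)
qed

text \<open>The finite Laplace transform of the semigroup, coordinate by coordinate: each coordinate of the
  integrand is a scalar exponential.\<close>

lemma cinner_finite_laplace: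
  assumes s: "Re s \<ge> 0" and b: "b \<ge> 0"
  shows "cinner (integral {0..b} (\<lambda>t. exp (- s * complex_of_real t) *\<^sub>C T t z)) (\<psi> n)
    = cinner z (\<psi> n) * (1 - exp ((\<mu> n - s) * complex_of_real b)) / (s - \<mu> n)"
proof -
  have nz: "\<mu> n - s \<noteq> 0" using s Re_neg[of n] by (auto simp: complex_eq_iff)
  let ?g = "\<lambda>t. exp (- s * complex_of_real t) *\<^sub>C T t z"
  have "continuous_on {0..b} ?g"
    by (rule continuous_on_subset[OF continuous_on_twisted_orbit[OF s]]) auto
  then have int: "?g integrable_on {0..b}" by (rule integrable_continuous_real)
  have "((\<lambda>t. exp ((\<mu> n - s) * complex_of_real t) * cinner z (\<psi> n)) has_integral
      exp ((\<mu> n - s) * complex_of_real b) * cinner z (\<psi> n) / (\<mu> n - s)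
      - exp ((\<mu> n - s) * complex_of_real 0) * cinner z (\<psi> n) / (\<mu> n - s)) {0..b}"
  proof (rule fundamental_theorem_of_calculus[OF b])
    fix t assume "t \<in> {0..b}"
    have "((\<lambda>z'. exp ((\<mu> n - s) * z') * cinner z (\<psi> n) / (\<mu> n - s)) has_field_derivative
        exp ((\<mu> n - s) * complex_of_real t) * cinner z (\<psi> n)) (at (complex_of_real t))"
      using nz by (auto intro!: derivative_eq_intros)
    then show "((\<lambda>t. exp ((\<mu> n - s) * complex_of_real t) * cinner z (\<psi> n) / (\<mu> n - s)) has_vector_derivative
        exp ((\<mu> n - s) * complex_of_real t) * cinner z (\<psi> n)) (at t within {0..b})"
      by (rule has_vector_derivative_real_field)
  qed
  moreover have "exp ((\<mu> n - s) * complex_of_real t) * cinner z (\<psi> n) = cinner (?g t) (\<psi> n)"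
    if "t \<in> {0..b}" for t
  proof -
    have t: "t \<ge> 0" using that by simp
    show ?thesis
      unfolding twisted_orbit[OF t s] by (rule cinner_diag[OF cmod_exp_le_1[OF t s], symmetric])
  qed
  ultimately have "((\<lambda>t. cinner (?g t) (\<psi> n)) has_integral
      exp ((\<mu> n - s) * complex_of_real b) * cinner z (\<psi> n) / (\<mu> n - s)
      - exp ((\<mu> n - s) * complex_of_real 0) * cinner z (\<psi> n) / (\<mu> n - s)) {0..b}"
    by (rule has_integral_eq[rotated])
  moreover have "((\<lambda>t. cinner (?g t) (\<psi> n)) has_integral cinner (integral {0..b} ?g) (\<psi> n)) {0..b}"
    using has_integral_linear[OF integrable_integral[OF int] bounded_linear_cinner_left, of "\<psi> n"]
    by (simp add: o_def)
  ultimately have "cinner (integral {0..b} ?g) (\<psi> n) =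
      exp ((\<mu> n - s) * complex_of_real b) * cinner z (\<psi> n) / (\<mu> n - s)
      - exp ((\<mu> n - s) * complex_of_real 0) * cinner z (\<psi> n) / (\<mu> n - s)"
    by (rule has_integral_unique[rotated])
  then show ?thesis using nz by (simp add: field_simps)
qed

text \<open>At \<open>s = 1\<close> the Laplace integral converges on the half-line to the resolvent, which has the
  symbol \<open>1 / (1 - \<mu>\<^sub>n)\<close>.\<close>

lemma neg_frac_power_one: "neg_frac_power T 1 1 z = diag (\<lambda>n. 1 / (1 - \<mu> n)) z"
proof -
  obtain M where M: "M > 0" "\<And>t z. t \<ge> 0 \<Longrightarrow> norm (T t z) \<le> M * norm z" using ex_T_bound by blast
  have b: "cmod (1 / (1 - \<mu> n)) \<le> 1" for n
  proof -
    have "1 \<le> Re (1 - \<mu> n)" using Re_neg[of n] by simp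
    also have "\<dots> \<le> cmod (1 - \<mu> n)" by (rule complex_Re_le_cmod)
    finally show ?thesis by (simp add: norm_divide divide_le_eq)
  qed
  define y where "y = diag (\<lambda>n. 1 / (1 - \<mu> n)) z"
  have y: "cinner y (\<psi> n) = cinner z (\<psi> n) / (1 - \<mu> n)" for n
    unfolding y_def by (subst cinner_diag[OF b]) simp
  let ?g = "\<lambda>t. exp (- t) *\<^sub>R T t z"
  have g: "?g t = exp (- 1 * complex_of_real t) *\<^sub>C T t z" for t
    by (simp add: scaleR_scaleC exp_of_real[symmetric])
  have int: "(?g has_integral y - exp (- b) *\<^sub>R T b y) {0..b}" if b0: "b \<ge> 0" for b
  proof -
    have "continuous_on {0..b} ?g"
      unfolding g by (rule continuous_on_subset[OF continuous_on_twisted_orbit]) auto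
    then have "?g integrable_on {0..b}" by (rule integrable_continuous_real)
    moreover have "integral {0..b} ?g = y - exp (- b) *\<^sub>R T b y"
    proof (rule eq_by_coordinates)
      fix n
      have nz: "1 - \<mu> n \<noteq> 0" using Re_neg[of n] by (auto simp: complex_eq_iff)
      have "exp ((\<mu> n - 1) * complex_of_real b)
          = complex_of_real (exp (- b)) * exp (\<mu> n * complex_of_real b)"
        by (simp add: exp_of_real[symmetric] exp_add[symmetric] algebra_simps)
      then show "cinner (integral {0..b} ?g) (\<psi> n) = cinner (y - exp (- b) *\<^sub>R T b y) (\<psi> n)"
        unfolding g using b0 nz
        by (subst cinner_finite_laplace)
          (auto simp: cinner_diff_left scaleR_scaleC cinner_scaleC_left cinner_T y diff_divide_distrib
            right_diff_distrib mult_ac)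
    qed
    ultimately show ?thesis by (metis integrable_integral)
  qed
  have "(?g has_integral y) {0..}"
    unfolding has_integral'[of ?g]
  proof (intro allI impI)
    fix e :: real assume e: "e > 0"
    have "((\<lambda>b. exp (- b) * (M * norm y)) \<longlongrightarrow> 0 * (M * norm y)) at_top"
      by (intro tendsto_mult_right filterlim_compose[OF exp_at_bot filterlim_uminus_at_bot_at_top])
    then have "\<forall>\<^sub>F b in at_top. exp (- b) * (M * norm y) < e"
      using e by (intro order_tendstoD(2)) auto
    then obtain B where B: "\<And>b. b \<ge> B \<Longrightarrow> exp (- b) * (M * norm y) < e"
      unfolding eventually_at_top_linorder by blast
    show "\<exists>B>0. \<forall>a b. ball 0 B \<subseteq> cbox a b \<longrightarrow>
        (\<exists>w. ((\<lambda>x. if x \<in> {0..} then ?g x else 0) has_integral w) (cbox a b) \<and> norm (w - y) < e)"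
    proof (intro exI[of _ "max B 1"] conjI allI impI)
      fix a b :: real assume ab: "ball 0 (max B 1) \<subseteq> cbox a b"
      have "cball (0::real) (max B 1) \<subseteq> cbox a b"
        using closure_minimal[OF ab] by (simp add: closure_ball)
      moreover have "max B 1 \<in> cball (0::real) (max B 1)" "- max B 1 \<in> cball (0::real) (max B 1)"
        by (auto simp: dist_norm)
      ultimately have "max B 1 \<in> cbox a b" "- max B 1 \<in> cbox a b" by blast+
      then have *: "a \<le> - max B 1" "max B 1 \<le> b" by auto
      then have "{0..} \<inter> cbox a b = {0..b}" by auto
      moreover have "(?g has_integral y - exp (- b) *\<^sub>R T b y) {0..b}" using * by (intro int) auto
      ultimately have "((\<lambda>x. if x \<in> {0..} then ?g x else 0) has_integral y - exp (- b) *\<^sub>R T b y) (cbox a b)"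
        by (simp only: has_integral_restrict_Int)
      moreover have "norm (y - exp (- b) *\<^sub>R T b y - y) < e"
      proof -
        have "norm (y - exp (- b) *\<^sub>R T b y - y) = exp (- b) * norm (T b y)" by simp
        also have "\<dots> \<le> exp (- b) * (M * norm y)" using M(2)[of b y] * by (intro mult_left_mono) auto
        also have "\<dots> < e" using B[of b] * by auto
        finally show ?thesis .
      qed
      ultimately show "\<exists>w. ((\<lambda>x. if x \<in> {0..} then ?g x else 0) has_integral w) (cbox a b)
          \<and> norm (w - y) < e" by blast
    qed simp
  qed
  \<comment> \<open>The weight \<open>t powr 0\<close> takes the value \<open>0\<close>, not \<open>1\<close>, at \<open>t = 0\<close>.\<close>
  then have "((\<lambda>t. (t powr (1 - 1) * exp (- 1 * t)) *\<^sub>R T t z) has_integral y) {0..}"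
    by (rule has_integral_spike_finite[of "{0}", rotated 2]) auto
  then show ?thesis
    unfolding neg_frac_power_def y_def[symmetric] by (subst integral_unique) auto
qed

end

text \<open>The elementary inequality \<open>y\<^sup>a e\<^sup>-\<^sup>y \<le> a\<^sup>a\<close>, which turns exponential into polynomial decay; it
  comes from \<open>ln (y/a) \<le> y/a - 1\<close>.\<close>

lemma exp_minus_le_powr:
  fixes a y :: real
  assumes "a > 0" "y > 0"
  shows "exp (- y) \<le> a powr a * y powr (- a)"
proof -
  have "ln (y / a) \<le> y / a - 1" using assms by (intro ln_le_minus_one) auto
  then have "a * (ln y - ln a) \<le> a * (y / a - 1)"
    using assms by (intro mult_left_mono) (auto simp: ln_div)
  then have "- y \<le> a * ln a + (- a) * ln y" using assms by (simp add: algebra_simps)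
  then have "exp (- y) \<le> exp (a * ln a + (- a) * ln y)" by simp
  also have "\<dots> = a powr a * y powr (- a)"
    using assms by (simp add: powr_def exp_add[symmetric])
  finally show ?thesis .
qed

locale polynomial_diagonal_semigroup = diagonal_semigroup \<phi> \<psi> \<mu> T
  for \<phi> \<psi> :: "int \<Rightarrow> 'z::complex_hilbert" and \<mu> T +
  fixes \<alpha> c d :: real
  assumes pos: "\<alpha> > 0" "c > 0" "d > 0"
    and Re_bound: "\<bar>Im (\<mu> n)\<bar> \<ge> d \<Longrightarrow> Re (\<mu> n) \<le> - c / \<bar>Im (\<mu> n)\<bar> powr \<alpha>"
begin

text \<open>High modes decay at rate at least \<open>c / \<bar>Im \<mu>\<^sub>n\<bar>\<^sup>\<alpha>\<close>, which costs a factor \<open>\<bar>Im \<mu>\<^sub>n\<bar> \<le> \<bar>\<mu>\<^sub>n\<bar>\<close>. The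
  remaining eigenvalues stay away from a compact piece of the imaginary axis, so they decay at a
  uniform exponential rate, and they are bounded away from \<open>0\<close>.\<close>

lemma ex_mode_decay:
  "\<exists>N>0. \<forall>t>0. \<forall>n. cmod (exp (\<mu> n * complex_of_real t)) \<le> N * t powr (- (1/\<alpha>)) * cmod (\<mu> n)"
proof -
  define a where "a = 1 / \<alpha>"
  have a: "a > 0" using pos by (simp add: a_def)
  obtain \<delta>0 where \<delta>0: "\<delta>0 > 0" "\<And>n. \<delta>0 \<le> cmod (\<mu> n)"
    using spectral_gap[of 0] by auto
  let ?J = "(\<lambda>x. \<i> * complex_of_real x) ` {-d..d}"
  have "compact ?J" by (intro compact_continuous_image continuous_intros) auto
  moreover have "?J \<inter> closure (range \<mu>) = {}" using spectrum_off_imaginary_axis by auto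
  ultimately obtain \<delta>1 where \<delta>1: "\<delta>1 > 0"
    "\<And>x y. x \<in> ?J \<Longrightarrow> y \<in> closure (range \<mu>) \<Longrightarrow> \<delta>1 \<le> dist x y"
    using separate_compact_closed[of ?J "closure (range \<mu>)"] by auto
  have low: "Re (\<mu> n) \<le> - \<delta>1" if "\<bar>Im (\<mu> n)\<bar> < d" for n
  proof -
    have "\<delta>1 \<le> dist (\<i> * complex_of_real (Im (\<mu> n))) (\<mu> n)"
    proof (rule \<delta>1(2))
      show "\<i> * complex_of_real (Im (\<mu> n)) \<in> ?J" using that by (intro imageI) auto
      show "\<mu> n \<in> closure (range \<mu>)" by (rule subsetD[OF closure_subset]) simp
    qed
    also have "dist (\<i> * complex_of_real (Im (\<mu> n))) (\<mu> n) = \<bar>Re (\<mu> n)\<bar>"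
      by (simp add: dist_norm cmod_def)
    finally show ?thesis using Re_neg[of n] by simp
  qed
  define N1 where "N1 = a powr a * c powr (- a)"
  define N2 where "N2 = a powr a * \<delta>1 powr (- a) / \<delta>0"
  have N: "N1 > 0" "N2 > 0" using a pos \<delta>0 \<delta>1 by (auto simp: N1_def N2_def)
  have "cmod (exp (\<mu> n * complex_of_real t)) \<le> (N1 + N2) * t powr (- a) * cmod (\<mu> n)"
    if t: "t > 0" for t n
  proof (cases "\<bar>Im (\<mu> n)\<bar> \<ge> d")
    case True
    define r where "r = \<bar>Im (\<mu> n)\<bar>"
    have r: "r > 0" using True pos by (simp add: r_def)
    have "cmod (exp (\<mu> n * complex_of_real t)) = exp (Re (\<mu> n) * t)" by simp
    also have "\<dots> \<le> exp (- (c * t * r powr (- \<alpha>)))"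
      using mult_right_mono[OF Re_bound[OF True], of t] t
      by (simp add: r_def powr_minus divide_inverse mult_ac)
    also have "\<dots> \<le> a powr a * (c * t * r powr (- \<alpha>)) powr (- a)"
      using a pos t r by (intro exp_minus_le_powr) auto
    also have "\<dots> = N1 * t powr (- a) * r"
      using pos t r by (simp add: N1_def powr_mult powr_powr a_def)
    also have "\<dots> \<le> (N1 + N2) * t powr (- a) * cmod (\<mu> n)"
      using N t abs_Im_le_cmod[of "\<mu> n"] by (intro mult_mono) (auto simp: r_def)
    finally show ?thesis .
  next
    case False
    have "cmod (exp (\<mu> n * complex_of_real t)) = exp (Re (\<mu> n) * t)" by simp
    also have "\<dots> \<le> exp (- (\<delta>1 * t))"
      using low[of n] False t mult_right_mono[of "Re (\<mu> n)" "- \<delta>1" t] by simp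
    also have "\<dots> \<le> a powr a * (\<delta>1 * t) powr (- a)"
      using a \<delta>1 t by (intro exp_minus_le_powr) auto
    also have "\<dots> = N2 * t powr (- a) * \<delta>0"
      using \<delta>1 \<delta>0 t by (simp add: N2_def powr_mult)
    also have "\<dots> \<le> (N1 + N2) * t powr (- a) * cmod (\<mu> n)"
      using N t \<delta>0 by (intro mult_mono) auto
    finally show ?thesis .
  qed
  then show ?thesis using N unfolding a_def by (intro exI[of _ "N1 + N2"]) auto
qed

text \<open>Hence any operator whose symbol is at most \<open>1 / \<bar>\<mu>\<^sub>n\<bar>\<close> smooths enough for the polynomial rate.\<close>

lemma ex_smoothed_decay:
  "\<exists>N>0. \<forall>e. (\<forall>n. cmod (e n) * cmod (\<mu> n) \<le> 1) \<longrightarrow>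
     (\<forall>t>0. \<forall>z. norm (diag (\<lambda>n. exp (\<mu> n * complex_of_real t) * e n) z) \<le> N * t powr (- (1/\<alpha>)) * norm z)"
proof -
  obtain K where K: "K > 0" "\<And>e N z. (\<And>n. cmod (e n) \<le> N) \<Longrightarrow> norm (diag e z) \<le> K * N * norm z"
    using ex_diag_bound by blast
  obtain N where N: "N > 0"
    "\<And>t n. t > 0 \<Longrightarrow> cmod (exp (\<mu> n * complex_of_real t)) \<le> N * t powr (- (1/\<alpha>)) * cmod (\<mu> n)"
    using ex_mode_decay by blast
  have "norm (diag (\<lambda>n. exp (\<mu> n * complex_of_real t) * e n) z) \<le> (K * N) * t powr (- (1/\<alpha>)) * norm z"
    if e: "\<forall>n. cmod (e n) * cmod (\<mu> n) \<le> 1" and t: "t > 0" for e t z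
  proof -
    have "cmod (exp (\<mu> n * complex_of_real t) * e n) \<le> N * t powr (- (1/\<alpha>))" for n
    proof -
      have "cmod (exp (\<mu> n * complex_of_real t) * e n) \<le> N * t powr (- (1/\<alpha>)) * cmod (\<mu> n) * cmod (e n)"
        unfolding norm_mult[of "exp _"] by (rule mult_right_mono[OF N(2)[OF t]]) simp
      also have "\<dots> = N * t powr (- (1/\<alpha>)) * (cmod (e n) * cmod (\<mu> n))" by simp
      also have "\<dots> \<le> N * t powr (- (1/\<alpha>)) * 1" using e N(1) by (intro mult_left_mono) auto
      finally show ?thesis by simp
    qed
    from K(2)[where z = z, OF this] show ?thesis by (simp add: mult_ac)
  qed
  then show ?thesis using K N by (intro exI[of _ "K * N"]) auto
qed

lemma domain_decay:
  assumes "z \<in> spectral_dom \<mu> \<psi>"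
  shows "\<exists>m>0. \<forall>t>0. norm (T t z) \<le> m * t powr (- (1/\<alpha>))"
proof -
  obtain N where N: "N > 0" "\<And>e t z. (\<And>n. cmod (e n) * cmod (\<mu> n) \<le> 1) \<Longrightarrow> t > 0 \<Longrightarrow>
      norm (diag (\<lambda>n. exp (\<mu> n * complex_of_real t) * e n) z) \<le> N * t powr (- (1/\<alpha>)) * norm z"
    using ex_smoothed_decay by blast
  have nz: "\<mu> n \<noteq> 0" for n using Re_neg[of n] by auto
  define y where "y = spectral_op \<mu> \<phi> \<psi> z"
  have "norm (T t z) \<le> (N * (norm y + 1)) * t powr (- (1/\<alpha>))" if t: "t > 0" for t
  proof -
    have "T t z = diag (\<lambda>n. exp (\<mu> n * complex_of_real t) * (1 / \<mu> n)) y"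
      using t nz by (simp add: T_diag diag_def y_def cinner_spectral_op[OF assms])
    moreover have "norm (diag (\<lambda>n. exp (\<mu> n * complex_of_real t) * (1 / \<mu> n)) y)
        \<le> N * t powr (- (1/\<alpha>)) * norm y"
      using t nz by (intro N(2)) (auto simp: norm_divide)
    moreover have "\<dots> \<le> N * t powr (- (1/\<alpha>)) * (norm y + 1)"
      using N(1) by (intro mult_left_mono) auto
    ultimately show ?thesis by (simp add: mult_ac)
  qed
  then show ?thesis using N by (intro exI[of _ "N * (norm y + 1)"]) (auto intro!: mult_pos_pos add_nonneg_pos)
qed

text \<open>The witness is the resolvent at \<open>1\<close>, that is, the exponent \<open>1\<close> at the point \<open>1\<close> above the growth bound
  of a bounded semigroup; \<open>\<bar>1 - \<mu>\<^sub>n\<bar> \<ge> \<bar>\<mu>\<^sub>n\<bar>\<close> because \<open>Re \<mu>\<^sub>n < 0\<close>.\<close>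

lemma polynomially_stable_T: "polynomially_stable T"
proof -
  obtain M where M: "M > 0" "\<And>t z. t \<ge> 0 \<Longrightarrow> norm (T t z) \<le> M * norm z" using ex_T_bound by blast
  obtain N where N: "N > 0" "\<And>e t z. (\<And>n. cmod (e n) * cmod (\<mu> n) \<le> 1) \<Longrightarrow> t > 0 \<Longrightarrow>
      norm (diag (\<lambda>n. exp (\<mu> n * complex_of_real t) * e n) z) \<le> N * t powr (- (1/\<alpha>)) * norm z"
    using ex_smoothed_decay by blast
  have le: "cmod (\<mu> n) \<le> cmod (1 - \<mu> n)" and ge1: "1 \<le> cmod (1 - \<mu> n)" for n
  proof -
    have "(cmod (\<mu> n))\<^sup>2 \<le> (cmod (1 - \<mu> n))\<^sup>2"
      unfolding cmod_power2 using Re_neg[of n] by (simp add: power2_eq_square algebra_simps)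
    then show "cmod (\<mu> n) \<le> cmod (1 - \<mu> n)" by (rule power2_le_imp_le) simp
    show "1 \<le> cmod (1 - \<mu> n)" using Re_neg[of n] complex_Re_le_cmod[of "1 - \<mu> n"] by simp
  qed
  have nz: "1 - \<mu> n \<noteq> 0" for n using ge1[of n] by (metis norm_zero not_one_le_zero)
  have "norm (T t (neg_frac_power T 1 1 z)) \<le> N * t powr (- (1/\<alpha>)) * norm z" if t: "t > 0" for t z
  proof -
    have b: "cmod (1 / (1 - \<mu> n)) \<le> 1" for n
      using ge1[of n] nz[of n] by (simp add: norm_divide divide_le_eq)
    have "T t (neg_frac_power T 1 1 z) = diag (\<lambda>n. exp (\<mu> n * complex_of_real t) * (1 / (1 - \<mu> n))) z"
      unfolding neg_frac_power_one T_diag[OF less_imp_le[OF t]] by (rule diag_diag[OF b])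
    then show ?thesis using N(2)[of "\<lambda>n. 1 / (1 - \<mu> n)" t z] t le nz
      by (simp add: norm_divide divide_le_eq)
  qed
  then show ?thesis
    unfolding polynomially_stable_def using M N pos
    by (intro exI[of _ 1] exI[of _ "1/\<alpha>"] exI[of _ M] exI[of _ N] conjI) auto
qed

end

section \<open>The signal space in Fourier coefficients\<close>

lemma norm_theta [simp]: "cmod (theta p k t) = 1"
  by (simp add: theta_def)

lemma theta_0 [simp]: "theta p k 0 = 1"
  by (simp add: theta_def)

lemma continuous_on_theta [continuous_intros]: "continuous_on S (theta p k)"
  unfolding theta_def by (intro continuous_intros)

lemma norm_exp_omega [simp]: "cmod (exp (\<i> * complex_of_real (omega p k * t))) = 1"
  by simp

lemma theta_orthogonal:
  assumes "p > 0"
  shows "((\<lambda>t. theta p j t * cnj (theta p k t)) has_integral (if j = k then complex_of_real p else 0)) {0..p}"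
proof -
  have eq: "theta p j t * cnj (theta p k t) = exp (\<i> * complex_of_real (omega p (j - k)) * complex_of_real t)" for t
    unfolding theta_def by (simp add: exp_cnj exp_add[symmetric] omega_def algebra_simps diff_divide_distrib)
  show ?thesis
  proof (cases "j = k")
    case True
    have "((\<lambda>t. 1::complex) has_integral complex_of_real p) {0..p}"
      using has_integral_const_real[of "1::complex" 0 p] assms by (simp add: scaleR_conv_of_real)
    then show ?thesis unfolding eq using True by (simp add: omega_def)
  next
    case False
    let ?m = "\<i> * complex_of_real (omega p (j - k))"
    have m: "?m \<noteq> 0" using False assms by (simp add: omega_def)
    have per: "exp (?m * complex_of_real p) = 1"
    proof -
      have "?m * complex_of_real p = complex_of_real (2 * real_of_int (j - k) * pi) * \<i>"
        using assms by (simp add: omega_def)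
      then show ?thesis by (simp only: exp_integer_2pi[OF Ints_of_int])
    qed
    have "((\<lambda>t. exp (?m * complex_of_real t)) has_integral
        exp (?m * complex_of_real p) / ?m - exp (?m * complex_of_real 0) / ?m) {0..p}"
    proof (rule fundamental_theorem_of_calculus)
      fix t
      have "((\<lambda>z. exp (?m * z) / ?m) has_field_derivative exp (?m * complex_of_real t)) (at (complex_of_real t))"
        using m by (auto intro!: derivative_eq_intros)
      then show "((\<lambda>t. exp (?m * complex_of_real t) / ?m) has_vector_derivative exp (?m * complex_of_real t))
          (at t within {0..p})"
        by (rule has_vector_derivative_real_field)
    qed (use assms in simp)
    then show ?thesis using False unfolding per eq by simp
  qed
qed

locale signal_space =
  fixes p :: real and f :: "int \<Rightarrow> real"
  assumes p_pos: "p > 0" and f_inv: "ell2 (\<lambda>k. inverse (f k))" and f_ge_1: "f k \<ge> 1"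
begin

abbreviation coef :: "(real \<Rightarrow> complex) \<Rightarrow> int \<Rightarrow> complex" where
  "coef y k \<equiv> L2_inner p y (theta p k)"

definition synth :: "(int \<Rightarrow> complex) \<Rightarrow> real \<Rightarrow> complex" where
  "synth a = (\<lambda>t. \<Sum>\<^sub>\<infinity>k. a k * theta p k t)"

abbreviation phase :: "real \<Rightarrow> int \<Rightarrow> complex" where
  "phase t k \<equiv> exp (\<i> * complex_of_real (omega p k * t))"

text \<open>By Cauchy-Schwarz, a scalar sequence \<open>h\<close> defines a bounded functional in the weighted
  coefficients as soon as \<open>h / f\<close> is square summable. The case \<open>h = 1\<close> bounds the evaluation of
  Fourier series, uniformly in the point.\<close>

lemma bessel_functional:
  assumes "ell2 (\<lambda>k. h k * complex_of_real (inverse (f k)))"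
  shows "\<exists>K. bessel K f h"
proof -
  let ?q = "\<lambda>k. (cmod (h k * complex_of_real (inverse (f k))))\<^sup>2"
  have q: "?q summable_on UNIV" using assms unfolding ell2_def .
  have fk: "f k > 0" for k using f_ge_1[of k] by linarith
  have "(cmod (\<Sum>k\<in>F. a k *\<^sub>C h k))\<^sup>2 \<le> infsum ?q UNIV * (\<Sum>k\<in>F. (cmod (a k))\<^sup>2 * (f k)\<^sup>2)"
    if F: "finite F" for F a
  proof -
    have "cmod (\<Sum>k\<in>F. a k *\<^sub>C h k)
        \<le> (\<Sum>k\<in>F. cmod (h k * complex_of_real (inverse (f k))) * (cmod (a k) * f k))"
    proof (rule sum_norm_le)
      fix k
      have "cmod (complex_of_real (inverse (f k))) = inverse (f k)"
        using fk[of k] by (simp add: norm_inverse)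
      then show "cmod (a k *\<^sub>C h k) \<le> cmod (h k * complex_of_real (inverse (f k))) * (cmod (a k) * f k)"
        unfolding scaleC_complex norm_mult using fk[of k] by (simp only:) (simp add: field_simps)
    qed
    then have "(cmod (\<Sum>k\<in>F. a k *\<^sub>C h k))\<^sup>2
        \<le> (\<Sum>k\<in>F. cmod (h k * complex_of_real (inverse (f k))) * (cmod (a k) * f k))\<^sup>2"
      by (rule power_mono) simp
    also have "\<dots> \<le> sum ?q F * (\<Sum>k\<in>F. (cmod (a k) * f k)\<^sup>2)"
      by (rule Cauchy_Schwarz_ineq_sum)
    also have "\<dots> \<le> infsum ?q UNIV * (\<Sum>k\<in>F. (cmod (a k) * f k)\<^sup>2)"
      by (intro mult_right_mono finite_sum_le_infsum[OF q F] sum_nonneg) auto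
    finally show ?thesis by (simp add: power_mult_distrib)
  qed
  moreover have "infsum ?q UNIV \<ge> 0" by (intro infsum_nonneg) simp
  ultimately show ?thesis unfolding bessel_def by blast
qed

lemma ex_bessel_one: "\<exists>K. bessel K f (\<lambda>_. 1::complex)"
proof (rule bessel_functional)
  show "ell2 (\<lambda>k. 1 * complex_of_real (inverse (f k)))"
    using f_inv by (simp add: ell2_def norm_inverse)
qed

lemma synth_has_sum:
  assumes "sq_summable f a"
  shows "((\<lambda>k. a k * theta p k t) has_sum synth a t) UNIV"
proof -
  obtain K where K: "bessel K f (\<lambda>_. 1::complex)" using ex_bessel_one by blast
  have "sq_summable f (\<lambda>k. theta p k t * a k)" by (rule sq_summable_phase[OF assms]) simp
  from bessel_has_sum[OF K this] show ?thesis by (simp add: synth_def mult.commute)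
qed

text \<open>A Fourier series determines its coefficients: it converges uniformly, so it may be integrated
  term by term against a character.\<close>

lemma coef_synth:
  assumes a: "sq_summable f a"
  shows "coef (synth a) k = a k"
proof -
  obtain K where K: "bessel K f (\<lambda>_. 1::complex)" using ex_bessel_one by blast
  let ?e = "\<lambda>t j. theta p j t * cnj (theta p k t)"
  have lim: "(\<Sum>\<^sub>\<infinity>j. (?e t j * a j) *\<^sub>C (1::complex)) = synth a t * cnj (theta p k t)" for t
    using has_sum_cmult_left[OF synth_has_sum[OF a, of t], of "cnj (theta p k t)"]
    by (intro infsumI) (simp add: mult_ac)
  have "uniform_limit {0..p} (\<lambda>F t. \<Sum>j\<in>F. (?e t j * a j) *\<^sub>C (1::complex))
      (\<lambda>t. synth a t * cnj (theta p k t)) (finite_subsets_at_top UNIV)"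
    unfolding lim[symmetric] by (rule bessel_uniform_limit[OF K a]) (simp add: norm_mult)
  then obtain I J where I: "\<And>F. ((\<lambda>t. \<Sum>j\<in>F. (?e t j * a j) *\<^sub>C (1::complex)) has_integral I F) {0..p}"
    and J: "((\<lambda>t. synth a t * cnj (theta p k t)) has_integral J) {0..p}"
    and IJ: "(I \<longlongrightarrow> J) (finite_subsets_at_top UNIV)"
    by (rule uniform_limit_integral) (auto intro!: continuous_intros continuous_on_sum)
  have "I F = a k * complex_of_real p" if F: "finite F" "k \<in> F" for F
  proof -
    have "((\<lambda>t. \<Sum>j\<in>F. ?e t j * a j) has_integral
        (\<Sum>j\<in>F. (if j = k then complex_of_real p else 0) * a j)) {0..p}"
      by (intro has_integral_sum F has_integral_mult_left theta_orthogonal p_pos)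
    moreover have "(\<Sum>j\<in>F. (if j = k then complex_of_real p else 0) * a j) = a k * complex_of_real p"
      using F by (simp add: if_distrib[of "\<lambda>x. x * _"] sum.delta cong: if_cong)
    ultimately show ?thesis using I[of F] by (auto intro: has_integral_unique)
  qed
  then have "\<forall>\<^sub>F F in finite_subsets_at_top UNIV. I F = a k * complex_of_real p"
    unfolding eventually_finite_subsets_at_top by (intro exI[of _ "{k}"]) auto
  then have "(I \<longlongrightarrow> a k * complex_of_real p) (finite_subsets_at_top UNIV)"
    by (rule tendsto_eventually)
  with IJ have "J = a k * complex_of_real p"
    using tendsto_unique finite_subsets_at_top_neq_bot by blast
  then show ?thesis using J p_pos by (simp add: L2_inner_def integral_unique)
qed

lemma W_spaceE:
  assumes "y \<in> W_space p f"
  shows "sq_summable f (coef y)" and "y = synth (coef y)"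
proof -
  obtain a where a: "sq_summable f a" "\<And>t. ((\<lambda>k. a k * theta p k t) has_sum y t) UNIV"
    using assms unfolding W_space_def sq_summable_def by blast
  have y: "y = synth a"
    using has_sum_unique[OF a(2) synth_has_sum[OF a(1)]] by auto
  then have "coef y = a" using coef_synth[OF a(1)] by auto
  with y a show "sq_summable f (coef y)" "y = synth (coef y)" by auto
qed

lemma synth_in_W: "sq_summable f a \<Longrightarrow> synth a \<in> W_space p f"
  unfolding W_space_def using synth_has_sum by (auto simp: sq_summable_def)

lemma S_domD:
  assumes "y \<in> S_dom p f"
  shows "y \<in> W_space p f" "sq_summable f (\<lambda>k. complex_of_real (omega p k) * coef y k)"
  using assms by (auto simp: S_dom_def sq_summable_def norm_mult power_mult_distrib)

lemma synth_finite: "finite F \<Longrightarrow> synth (\<lambda>k. if k \<in> F then a k else 0) = (\<lambda>t. \<Sum>k\<in>F. a k * theta p k t)"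
  unfolding synth_def by (intro ext infsumI has_sum_finite_neutralI[of F]) (auto split: if_splits)

lemma trig_coef: "finite F \<Longrightarrow> coef (\<lambda>t. \<Sum>k\<in>F. a k * theta p k t) j = (if j \<in> F then a j else 0)"
  unfolding synth_finite[symmetric] by (rule coef_synth[OF sq_summable_finite])

lemma trig_in_S_dom: "finite F \<Longrightarrow> (\<lambda>t. \<Sum>k\<in>F. a k * theta p k t) \<in> S_dom p f"
  unfolding S_dom_def mem_Collect_eq trig_coef
  using synth_in_W[OF sq_summable_finite, of F a]
  by (auto simp: synth_finite intro!: finite_nonzero_values_imp_summable_on intro: finite_subset[of _ F]
      split: if_splits)

lemma coef_theta: "coef (theta p k) j = (if j = k then 1 else 0)"
  using trig_coef[of "{k}" "\<lambda>_. 1" j] by simp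

lemma theta_in_S_dom: "theta p k \<in> S_dom p f"
  using trig_in_S_dom[of "{k}" "\<lambda>_. 1"] by simp

lemma theta_in_W: "theta p k \<in> W_space p f"
  using theta_in_S_dom S_domD by blast

lemma W_norm_trig:
  assumes "finite F"
  shows "W_norm p f (\<lambda>t. \<Sum>k\<in>F. a k * theta p k t) = sqrt (\<Sum>k\<in>F. (cmod (a k))\<^sup>2 * (f k)\<^sup>2)"
  unfolding W_norm_def trig_coef[OF assms]
  using assms by (intro arg_cong[of _ _ sqrt] infsumI has_sum_finite_neutralI[of F]) (auto split: if_splits)

lemma T_S_synth: "T_S p t y = synth (\<lambda>k. phase t k * coef y k)"
  by (simp add: T_S_def synth_def)

lemma sq_summable_group: "sq_summable f a \<Longrightarrow> sq_summable f (\<lambda>k. phase t k * a k)"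
  by (rule sq_summable_phase) simp_all

lemma T_S_in_W: "y \<in> W_space p f \<Longrightarrow> T_S p t y \<in> W_space p f"
  unfolding T_S_synth by (intro synth_in_W sq_summable_group W_spaceE)

lemma coef_T_S: "y \<in> W_space p f \<Longrightarrow> coef (T_S p t y) k = phase t k * coef y k"
  unfolding T_S_synth by (intro coef_synth sq_summable_group W_spaceE)

lemma T_S_theta: "T_S p t (theta p k) = (\<lambda>s. phase t k * theta p k s)"
  unfolding T_S_synth coef_theta
  using synth_finite[of "{k}" "phase t"] by (simp add: if_distrib cong: if_cong)

text \<open>Operators on \<open>W\<close>, or on a subspace that contains the trigonometric polynomials, are governed
  by their values on the characters: there the bound becomes a Bessel inequality, which can be
  extended from \<open>D(S)\<close> to all coefficient sequences of elements of \<open>W\<close>.\<close>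

lemma
  assumes X: "S_dom p f \<subseteq> X" and Op: "bounded_clinear_on X (W_norm p f) Op"
  shows operator_trig: "finite F \<Longrightarrow>
      Op (\<lambda>t. \<Sum>k\<in>F. a k * theta p k t) = (\<Sum>k\<in>F. a k *\<^sub>C Op (theta p k))"
    and operator_bessel: "\<exists>K. bessel K f (\<lambda>k. Op (theta p k))"
proof -
  have add: "\<And>u v. u \<in> X \<Longrightarrow> v \<in> X \<Longrightarrow> Op (\<lambda>t. u t + v t) = Op u + Op v"
    and scale: "\<And>a u. u \<in> X \<Longrightarrow> Op (\<lambda>t. a * u t) = a *\<^sub>C Op u"
    using Op unfolding bounded_clinear_on_def by auto
  obtain M where M: "\<And>u. u \<in> X \<Longrightarrow> norm (Op u) \<le> M * W_norm p f u"
    using Op unfolding bounded_clinear_on_def by blast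
  have trigX: "(\<lambda>t. \<Sum>k\<in>F. a k * theta p k t) \<in> X" if "finite F" for F a
    using trig_in_S_dom[OF that] X by blast
  have th: "theta p k \<in> X" for k using theta_in_S_dom X by blast
  show trig: "Op (\<lambda>t. \<Sum>k\<in>F. a k * theta p k t) = (\<Sum>k\<in>F. a k *\<^sub>C Op (theta p k))"
    if "finite F" for F a
    using that
  proof (induction F)
    case empty
    show ?case using scale[OF th, of 0 0] by simp
  next
    case (insert j F)
    have "Op (\<lambda>t. a j * theta p j t + (\<Sum>k\<in>F. a k * theta p k t))
        = Op (\<lambda>t. a j * theta p j t) + Op (\<lambda>t. \<Sum>k\<in>F. a k * theta p k t)"
      using trigX[of "{j}" a] by (intro add trigX insert) simp
    then show ?case using insert scale[OF th] by simp
  qed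
  have "(norm (\<Sum>k\<in>F. a k *\<^sub>C Op (theta p k)))\<^sup>2 \<le> M\<^sup>2 * (\<Sum>k\<in>F. (cmod (a k))\<^sup>2 * (f k)\<^sup>2)"
    if F: "finite F" for F a
  proof -
    have "norm (\<Sum>k\<in>F. a k *\<^sub>C Op (theta p k)) \<le> M * sqrt (\<Sum>k\<in>F. (cmod (a k))\<^sup>2 * (f k)\<^sup>2)"
      using M[OF trigX[OF F, of a]] unfolding trig[OF F] W_norm_trig[OF F] .
    then have "(norm (\<Sum>k\<in>F. a k *\<^sub>C Op (theta p k)))\<^sup>2 \<le> (M * sqrt (\<Sum>k\<in>F. (cmod (a k))\<^sup>2 * (f k)\<^sup>2))\<^sup>2"
      by (rule power_mono) simp
    then show ?thesis by (simp add: power_mult_distrib sum_nonneg)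
  qed
  then show "\<exists>K. bessel K f (\<lambda>k. Op (theta p k))" unfolding bessel_def by (intro exI[of _ "M\<^sup>2"]) auto
qed

lemma S_dom_subset: "S_dom p f \<subseteq> W_space p f"
  by (auto simp: S_dom_def)

text \<open>The partial sums of the Fourier series converge in the norm of \<open>W\<close>: the squared norm of a remainder
  is a tail of the convergent series that defines the norm.\<close>

lemma operator_expansion:
  assumes Op: "bounded_clinear_on (W_space p f) (W_norm p f) Op" and y: "y \<in> W_space p f"
  shows "Op y = (\<Sum>\<^sub>\<infinity>k. coef y k *\<^sub>C Op (theta p k))"
proof -
  have add: "\<And>u v. u \<in> W_space p f \<Longrightarrow> v \<in> W_space p f \<Longrightarrow> Op (\<lambda>t. u t + v t) = Op u + Op v"
    using Op unfolding bounded_clinear_on_def by auto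
  obtain M where M: "\<And>u. u \<in> W_space p f \<Longrightarrow> norm (Op u) \<le> M * W_norm p f u"
    using Op unfolding bounded_clinear_on_def by blast
  let ?q = "\<lambda>k. (cmod (coef y k))\<^sup>2 * (f k)\<^sup>2"
  have c: "sq_summable f (coef y)" and ysyn: "y = synth (coef y)" using W_spaceE[OF y] by auto
  have diff: "norm (Op y - (\<Sum>k\<in>F. coef y k *\<^sub>C Op (theta p k))) \<le> M * sqrt (infsum ?q (- F))"
    if F: "finite F" for F
  proof -
    define r where "r = synth (\<lambda>k. if k \<in> - F then coef y k else 0)"
    have sr: "sq_summable f (\<lambda>k. if k \<in> - F then coef y k else 0)" by (rule sq_summable_restrict[OF c])
    have rW: "r \<in> W_space p f" unfolding r_def by (rule synth_in_W[OF sr])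
    have "y t = (\<Sum>k\<in>F. coef y k * theta p k t) + r t" for t
    proof -
      have "((\<lambda>k. (if k \<in> F then coef y k else 0) * theta p k t + (if k \<in> - F then coef y k else 0) * theta p k t)
          has_sum (synth (\<lambda>k. if k \<in> F then coef y k else 0) t + r t)) UNIV"
        unfolding r_def by (intro has_sum_add synth_has_sum sq_summable_restrict c)
      also have "(\<lambda>k. (if k \<in> F then coef y k else 0) * theta p k t + (if k \<in> - F then coef y k else 0) * theta p k t)
          = (\<lambda>k. coef y k * theta p k t)" by auto
      finally have "synth (coef y) t = synth (\<lambda>k. if k \<in> F then coef y k else 0) t + r t"
        by (rule has_sum_unique[OF synth_has_sum[OF c]])
      then show ?thesis
        using fun_cong[OF ysyn, of t] by (simp only: synth_finite[OF F])
    qed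
    then have "Op y = Op (\<lambda>t. (\<Sum>k\<in>F. coef y k * theta p k t) + r t)"
      by (intro arg_cong[of _ _ Op] ext)
    also have "\<dots> = Op (\<lambda>t. \<Sum>k\<in>F. coef y k * theta p k t) + Op r"
      by (intro add) (use trig_in_S_dom[OF F] S_dom_subset rW in auto)
    finally have "Op y - (\<Sum>k\<in>F. coef y k *\<^sub>C Op (theta p k)) = Op r"
      using operator_trig[OF S_dom_subset Op F] by simp
    moreover have "norm (Op r) \<le> M * W_norm p f r" by (rule M[OF rW])
    moreover have "W_norm p f r = sqrt (infsum ?q (- F))"
      unfolding W_norm_def r_def coef_synth[OF sr]
      by (intro arg_cong[of _ _ sqrt] infsum_cong_neutral) auto
    ultimately show ?thesis by simp
  qed
  have lim: "((\<lambda>F. M * sqrt (infsum ?q (- F))) \<longlongrightarrow> M * sqrt 0) (finite_subsets_at_top UNIV)"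
    using c unfolding sq_summable_def by (intro tendsto_intros infsum_Compl_tendsto_0)
  have "\<forall>\<^sub>F F in finite_subsets_at_top UNIV.
      norm (Op y - (\<Sum>k\<in>F. coef y k *\<^sub>C Op (theta p k))) \<le> M * sqrt (infsum ?q (- F))"
    by (rule eventually_finite_subsets_at_top_weakI) (rule diff)
  from Lim_null_comparison[OF this] lim
  have "((\<lambda>F. Op y - (\<Sum>k\<in>F. coef y k *\<^sub>C Op (theta p k))) \<longlongrightarrow> 0) (finite_subsets_at_top UNIV)"
    by (simp only: real_sqrt_zero mult_zero_right)
  then have "((\<lambda>F. Op y - (Op y - (\<Sum>k\<in>F. coef y k *\<^sub>C Op (theta p k)))) \<longlongrightarrow> Op y - 0) (finite_subsets_at_top UNIV)"
    by (intro tendsto_intros)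
  then have "((\<lambda>k. coef y k *\<^sub>C Op (theta p k)) has_sum Op y) UNIV" by (simp add: has_sum_def)
  then show ?thesis by (simp add: infsumI)
qed

lemma bounded_clinear_on_synthesis:
  assumes g: "bessel K f g" and Op: "\<And>y. y \<in> W_space p f \<Longrightarrow> Op y = (\<Sum>\<^sub>\<infinity>k. coef y k *\<^sub>C g k)"
  shows "bounded_clinear_on (W_space p f) (W_norm p f) Op"
  unfolding bounded_clinear_on_def
proof (intro conjI ballI allI exI)
  fix u v assume u: "u \<in> W_space p f" and v: "v \<in> W_space p f"
  note cu = W_spaceE[OF u] and cv = W_spaceE[OF v]
  have "(\<lambda>t. u t + v t) = synth (\<lambda>k. coef u k + coef v k)"
  proof
    fix t
    have "((\<lambda>k. coef u k * theta p k t + coef v k * theta p k t) has_sum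
        (synth (coef u) t + synth (coef v) t)) UNIV"
      by (intro has_sum_add synth_has_sum cu cv)
    then show "u t + v t = synth (\<lambda>k. coef u k + coef v k) t"
      using cu(2) cv(2) infsumI unfolding synth_def[of "\<lambda>k. coef u k + coef v k"]
      by (metis (no_types, lifting) distrib_right infsum_cong)
  qed
  moreover have s: "sq_summable f (\<lambda>k. coef u k + coef v k)" by (intro sq_summable_add cu cv)
  ultimately have W: "(\<lambda>t. u t + v t) \<in> W_space p f" "coef (\<lambda>t. u t + v t) k = coef u k + coef v k" for k
    using synth_in_W[OF s] coef_synth[OF s] by auto
  have "((\<lambda>k. coef u k *\<^sub>C g k + coef v k *\<^sub>C g k) has_sum (Op u + Op v)) UNIV"
    unfolding Op[OF u] Op[OF v] by (intro has_sum_add bessel_has_sum[OF g] cu cv)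
  then show "Op (\<lambda>t. u t + v t) = Op u + Op v"
    unfolding Op[OF W(1)] W(2) by (intro infsumI) (simp add: scaleC_add_left)
next
  fix a u assume u: "u \<in> W_space p f"
  note cu = W_spaceE[OF u]
  have "(\<lambda>t. a * u t) = synth (\<lambda>k. a * coef u k)"
  proof
    fix t
    have "((\<lambda>k. a * (coef u k * theta p k t)) has_sum (a * synth (coef u) t)) UNIV"
      by (intro has_sum_cmult_right synth_has_sum cu)
    then show "a * u t = synth (\<lambda>k. a * coef u k) t"
      using cu(2) infsumI unfolding synth_def[of "\<lambda>k. a * coef u k"]
      by (metis (no_types, lifting) mult.assoc infsum_cong)
  qed
  moreover have s: "sq_summable f (\<lambda>k. a * coef u k)" by (intro sq_summable_scale cu)
  ultimately have W: "(\<lambda>t. a * u t) \<in> W_space p f" "coef (\<lambda>t. a * u t) k = a * coef u k" for k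
    using synth_in_W[OF s] coef_synth[OF s] by auto
  have "((\<lambda>k. a *\<^sub>C (coef u k *\<^sub>C g k)) has_sum a *\<^sub>C Op u) UNIV"
    unfolding Op[OF u] by (intro scaleC_has_sum bessel_has_sum[OF g] cu)
  then show "Op (\<lambda>t. a * u t) = a *\<^sub>C Op u"
    unfolding Op[OF W(1)] W(2) by (intro infsumI) (simp add: scaleC_scaleC)
next
  fix u assume u: "u \<in> W_space p f"
  have K: "K \<ge> 0" using g by (simp add: bessel_def)
  have "(norm (Op u))\<^sup>2 \<le> K * (\<Sum>\<^sub>\<infinity>k. (cmod (coef u k))\<^sup>2 * (f k)\<^sup>2)"
    unfolding Op[OF u] by (rule bessel_norm[OF g W_spaceE(1)[OF u]])
  then have "sqrt ((norm (Op u))\<^sup>2) \<le> sqrt (K * (\<Sum>\<^sub>\<infinity>k. (cmod (coef u k))\<^sup>2 * (f k)\<^sup>2))"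
    by (rule real_sqrt_le_mono)
  then show "norm (Op u) \<le> sqrt K * W_norm p f u"
    by (simp add: W_norm_def real_sqrt_mult)
qed

end

section \<open>The regulated plant\<close>

locale regulated_plant =
  polynomial_diagonal_semigroup \<phi> \<psi> \<mu> T \<alpha> c d + signal_space p f
  for \<phi> \<psi> :: "int \<Rightarrow> 'z::complex_hilbert" and \<mu> T \<alpha> c d p f
begin

abbreviation spectral_param :: "int \<Rightarrow> complex" where
  "spectral_param k \<equiv> \<i> * complex_of_real (omega p k)"

text \<open>The response to one harmonic: if \<open>g = R(i \<omega>\<^sub>k, A) v\<close>, then forcing with \<open>v\<close> at the frequency
  \<open>\<omega>\<^sub>k\<close> from rest produces the periodic motion through \<open>g\<close> minus the free motion started at \<open>g\<close>.\<close>

lemma harmonic_response: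
  assumes t: "t \<ge> 0" and g: "\<And>n. cinner g (\<psi> n) = cinner v (\<psi> n) / (spectral_param k - \<mu> n)"
  shows "((\<lambda>s. phase s k *\<^sub>C T (t - s) v) has_integral phase t k *\<^sub>C g - T t g) {0..t}"
proof -
  let ?s = "spectral_param k"
  let ?h = "\<lambda>r. exp (- ?s * complex_of_real r) *\<^sub>C T r v"
  have s: "Re ?s \<ge> 0" by simp
  have "continuous_on {0..t} ?h"
    by (rule continuous_on_subset[OF continuous_on_twisted_orbit[OF s]]) auto
  then have "?h integrable_on {0..t}" by (rule integrable_continuous_real)
  moreover have "integral {0..t} ?h = g - exp (- ?s * complex_of_real t) *\<^sub>C T t g"
  proof (rule eq_by_coordinates)
    fix n
    have e: "exp ((\<mu> n - ?s) * complex_of_real t) = exp (- ?s * complex_of_real t) * exp (\<mu> n * complex_of_real t)"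
      by (simp add: exp_add[symmetric] algebra_simps)
    have alg: "x * (1 - b * c) / q = x / q - b * (c * (x / q))" for x b c q :: complex
      by (simp add: diff_divide_distrib right_diff_distrib mult_ac)
    show "cinner (integral {0..t} ?h) (\<psi> n) = cinner (g - exp (- ?s * complex_of_real t) *\<^sub>C T t g) (\<psi> n)"
      unfolding cinner_finite_laplace[OF s t] cinner_diff_left cinner_scaleC_left cinner_T[OF t] g e
      by (rule alg)
  qed
  ultimately have "(?h has_integral g - exp (- ?s * complex_of_real t) *\<^sub>C T t g) (cbox 0 t)"
    by (metis integrable_integral cbox_interval)
  from has_integral_affinity[OF this, of "-1" t]
  have "((\<lambda>r. ?h (t - r)) has_integral g - exp (- ?s * complex_of_real t) *\<^sub>C T t g) ((\<lambda>x. t - x) ` {0..t})"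
    by (simp add: algebra_simps)
  moreover have "(\<lambda>x. t - x) ` {0..t} = {0..t}"
    using image_diff_atLeastAtMost[of t 0 t] by simp
  ultimately have "((\<lambda>r. phase t k *\<^sub>C ?h (t - r)) has_integral
      phase t k *\<^sub>C (g - exp (- ?s * complex_of_real t) *\<^sub>C T t g)) {0..t}"
    using has_integral_linear[OF _ bounded_linear_scaleC_right, of "\<lambda>r. ?h (t - r)"] by (simp add: o_def)
  moreover have "phase t k *\<^sub>C ?h (t - r) = phase r k *\<^sub>C T (t - r) v" for r
    by (simp add: scaleC_scaleC exp_add[symmetric] algebra_simps)
  moreover have "phase t k *\<^sub>C (g - exp (- ?s * complex_of_real t) *\<^sub>C T t g) = phase t k *\<^sub>C g - T t g"
    by (simp add: scaleC_scaleC scaleC_diff_right exp_add[symmetric] algebra_simps)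
  ultimately show ?thesis by simp
qed

text \<open>Superposition over all harmonics. Uniform convergence on \<open>[0, t]\<close> follows from the Bessel bound on
  the inputs and the boundedness of the semigroup, so the superposition is valid on all of \<open>W\<close>.\<close>

lemma periodic_response:
  assumes t: "t \<ge> 0" and a: "sq_summable f a"
    and v: "bessel K f v" and g: "bessel J f g"
    and gv: "\<And>k n. cinner (g k) (\<psi> n) = cinner (v k) (\<psi> n) / (spectral_param k - \<mu> n)"
  shows "integral {0..t} (\<lambda>s. T (t - s) (\<Sum>\<^sub>\<infinity>k. (phase s k * a k) *\<^sub>C v k))
    = (\<Sum>\<^sub>\<infinity>k. (phase t k * a k) *\<^sub>C g k) - T t (\<Sum>\<^sub>\<infinity>k. a k *\<^sub>C g k)"
proof -
  obtain M where M: "M > 0" "\<And>t z. t \<ge> 0 \<Longrightarrow> norm (T t z) \<le> M * norm z" using ex_T_bound by blast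
  have K: "K \<ge> 0" using v by (simp add: bessel_def)
  define x where "x s k = (phase s k * a k) *\<^sub>C T (t - s) (v k)" for s k
  have sumT: "sum (x s) F = T (t - s) (\<Sum>k\<in>F. (phase s k * a k) *\<^sub>C v k)" if "s \<in> {0..t}" for s F
    using that by (subst bounded_clinearD(6)[OF T_clinear]) (auto simp: x_def)
  have infT: "infsum (x s) UNIV = T (t - s) (\<Sum>\<^sub>\<infinity>k. (phase s k * a k) *\<^sub>C v k)" if s: "s \<in> {0..t}" for s
  proof (rule infsumI)
    have cl: "bounded_clinear (T (t - s))" using s by (intro T_clinear) auto
    from has_sum_bounded_linear[OF bounded_clinearD(1)[OF cl] bessel_has_sum[OF v sq_summable_group[OF a]]]
    show "(x s has_sum T (t - s) (\<Sum>\<^sub>\<infinity>k. (phase s k * a k) *\<^sub>C v k)) UNIV"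
      unfolding x_def bounded_clinearD(2)[OF cl] .
  qed
  have "uniform_limit {0..t} (\<lambda>F s. sum (x s) F) (\<lambda>s. infsum (x s) UNIV) (finite_subsets_at_top UNIV)"
  proof (rule uniform_limit_sum_square_bound[where K = "M\<^sup>2 * K" and q = "\<lambda>k. (cmod (a k))\<^sup>2 * (f k)\<^sup>2"])
    fix s :: real and F :: "int set" assume s: "s \<in> {0..t}" and F: "finite F"
    have "norm (sum (x s) F) \<le> M * norm (\<Sum>k\<in>F. (phase s k * a k) *\<^sub>C v k)"
      unfolding sumT[OF s] using s by (intro M) auto
    then have "(norm (sum (x s) F))\<^sup>2 \<le> M\<^sup>2 * (norm (\<Sum>k\<in>F. (phase s k * a k) *\<^sub>C v k))\<^sup>2"
      unfolding power_mult_distrib[symmetric] by (rule power_mono) simp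
    also have "\<dots> \<le> M\<^sup>2 * (K * (\<Sum>k\<in>F. (cmod (phase s k * a k))\<^sup>2 * (f k)\<^sup>2))"
      using v F unfolding bessel_def by (intro mult_left_mono) auto
    also have "\<dots> = M\<^sup>2 * K * (\<Sum>k\<in>F. (cmod (a k))\<^sup>2 * (f k)\<^sup>2)"
      by (simp add: norm_mult)
    finally show "(norm (sum (x s) F))\<^sup>2 \<le> M\<^sup>2 * K * (\<Sum>k\<in>F. (cmod (a k))\<^sup>2 * (f k)\<^sup>2)" .
  qed (use K a in \<open>auto simp: sq_summable_def\<close>)
  then have ul: "uniform_limit {0..t} (\<lambda>F s. sum (x s) F)
      (\<lambda>s. T (t - s) (\<Sum>\<^sub>\<infinity>k. (phase s k * a k) *\<^sub>C v k)) (finite_subsets_at_top UNIV)"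
    using uniform_limit_cong'[of "{0..t}"] infT by (metis (no_types, lifting))
  have cont: "continuous_on {0..t} (\<lambda>s. sum (x s) F)" for F
  proof -
    have "continuous_on {0..t} (\<lambda>s. (phase t k * a k) *\<^sub>C (exp (- spectral_param k * complex_of_real (t - s)) *\<^sub>C T (t - s) (v k)))" for k
      by (rule bounded_linear.continuous_on[OF bounded_linear_scaleC_right],
          rule continuous_on_compose2[OF continuous_on_twisted_orbit, of _ _ "\<lambda>s. t - s"])
        (auto intro!: continuous_intros)
    moreover have "(phase t k * a k) *\<^sub>C (exp (- spectral_param k * complex_of_real (t - s)) *\<^sub>C T (t - s) (v k)) = x s k" for s k
    proof -
      have "phase t k * exp (- spectral_param k * complex_of_real (t - s)) = phase s k"
        by (simp add: exp_add[symmetric] algebra_simps)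
      then show ?thesis by (simp add: x_def scaleC_scaleC mult_ac del: mult_minus_left)
    qed
    ultimately show ?thesis by (intro continuous_on_sum) simp
  qed
  from uniform_limit_integral[OF ul cont] obtain I R
    where I: "\<And>F. ((\<lambda>s. sum (x s) F) has_integral I F) {0..t}"
      and R: "((\<lambda>s. T (t - s) (\<Sum>\<^sub>\<infinity>k. (phase s k * a k) *\<^sub>C v k)) has_integral R) {0..t}"
      and IR: "(I \<longlongrightarrow> R) (finite_subsets_at_top UNIV)"
    using finite_subsets_at_top_neq_bot by blast
  have cl: "bounded_clinear (T t)" by (rule T_clinear[OF t])
  have "(\<lambda>s. x s k) = (\<lambda>s. a k *\<^sub>C (phase s k *\<^sub>C T (t - s) (v k)))" for k
    by (simp add: x_def scaleC_scaleC mult.commute)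
  then have "((\<lambda>s. x s k) has_integral a k *\<^sub>C (phase t k *\<^sub>C g k - T t (g k))) {0..t}" for k
    using has_integral_linear[OF harmonic_response[where k = k, OF t gv] bounded_linear_scaleC_right[of "a k"]]
    by (simp add: o_def)
  then have "((\<lambda>s. sum (x s) F) has_integral (\<Sum>k\<in>F. a k *\<^sub>C (phase t k *\<^sub>C g k - T t (g k)))) {0..t}"
    if "finite F" for F using that by (intro has_integral_sum)
  then have IF: "I F = (\<Sum>k\<in>F. a k *\<^sub>C (phase t k *\<^sub>C g k - T t (g k)))" if "finite F" for F
    using that I[of F] has_integral_unique by blast
  have "((\<lambda>k. (phase t k * a k) *\<^sub>C g k + (- a k) *\<^sub>C T t (g k)) has_sum
      ((\<Sum>\<^sub>\<infinity>k. (phase t k * a k) *\<^sub>C g k) + T t (\<Sum>\<^sub>\<infinity>k. (- a k) *\<^sub>C g k))) UNIV"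
  proof (rule has_sum_add)
    show "((\<lambda>k. (phase t k * a k) *\<^sub>C g k) has_sum (\<Sum>\<^sub>\<infinity>k. (phase t k * a k) *\<^sub>C g k)) UNIV"
      by (rule bessel_has_sum[OF g sq_summable_group[OF a]])
    have "sq_summable f (\<lambda>k. - a k)" using sq_summable_scale[OF a, of "-1"] by simp
    from has_sum_bounded_linear[OF bounded_clinearD(1)[OF cl] bessel_has_sum[OF g this]]
    show "((\<lambda>k. (- a k) *\<^sub>C T t (g k)) has_sum T t (\<Sum>\<^sub>\<infinity>k. (- a k) *\<^sub>C g k)) UNIV"
      unfolding bounded_clinearD(2)[OF cl] .
  qed
  moreover have "(\<Sum>\<^sub>\<infinity>k. (- a k) *\<^sub>C g k) = - (\<Sum>\<^sub>\<infinity>k. a k *\<^sub>C g k)"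
    by (simp add: scaleC_minus_left infsum_uminus)
  moreover have "T t (- z) = - T t z" for z
    using bounded_clinearD(4)[OF cl, of 0 z] bounded_clinearD(5)[OF cl] by simp
  moreover have "(phase t k * a k) *\<^sub>C g k + (- a k) *\<^sub>C T t (g k) = a k *\<^sub>C (phase t k *\<^sub>C g k - T t (g k))" for k
    by (simp add: scaleC_scaleC scaleC_diff_right scaleC_minus_left mult.commute)
  ultimately have "((\<lambda>k. a k *\<^sub>C (phase t k *\<^sub>C g k - T t (g k))) has_sum
      ((\<Sum>\<^sub>\<infinity>k. (phase t k * a k) *\<^sub>C g k) - T t (\<Sum>\<^sub>\<infinity>k. a k *\<^sub>C g k))) UNIV"
    by simp
  then have "(I \<longlongrightarrow> (\<Sum>\<^sub>\<infinity>k. (phase t k * a k) *\<^sub>C g k) - T t (\<Sum>\<^sub>\<infinity>k. a k *\<^sub>C g k)) (finite_subsets_at_top UNIV)"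
    unfolding has_sum_def
    by (rule Lim_transform_eventually) (auto intro!: eventually_finite_subsets_at_top_weakI simp: IF)
  then have "R = (\<Sum>\<^sub>\<infinity>k. (phase t k * a k) *\<^sub>C g k) - T t (\<Sum>\<^sub>\<infinity>k. a k *\<^sub>C g k)"
    using IR tendsto_unique finite_subsets_at_top_neq_bot by blast
  then show ?thesis using R by (simp add: integral_unique)
qed

text \<open>For smooth signals the periodic state lies in the domain of the generator. In coordinates this is
  the Sylvester equation: \<open>\<mu>\<^sub>n / (i \<omega>\<^sub>k - \<mu>\<^sub>n) = i \<omega>\<^sub>k / (i \<omega>\<^sub>k - \<mu>\<^sub>n) - 1\<close>, so multiplying by \<open>\<mu>\<^sub>n\<close> amounts
  to differentiating the signal and subtracting the input.\<close>

lemma periodic_state_in_domain: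
  assumes a: "sq_summable f a" and wa: "sq_summable f (\<lambda>k. complex_of_real (omega p k) * a k)"
    and v: "bessel K f v" and g: "bessel J f g"
    and gv: "\<And>k n. cinner (g k) (\<psi> n) = cinner (v k) (\<psi> n) / (spectral_param k - \<mu> n)"
  shows "(\<Sum>\<^sub>\<infinity>k. a k *\<^sub>C g k) \<in> spectral_dom \<mu> \<psi>"
proof -
  let ?b = "\<lambda>k. \<i> * (complex_of_real (omega p k) * a k)"
  define y where "y = (\<Sum>\<^sub>\<infinity>k. ?b k *\<^sub>C g k) + (\<Sum>\<^sub>\<infinity>k. (- 1 * a k) *\<^sub>C v k)"
  have "\<mu> n * cinner (\<Sum>\<^sub>\<infinity>k. a k *\<^sub>C g k) (\<psi> n) = cinner y (\<psi> n)" for n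
  proof -
    have "((\<lambda>k. \<mu> n * cinner (a k *\<^sub>C g k) (\<psi> n)) has_sum \<mu> n * cinner (\<Sum>\<^sub>\<infinity>k. a k *\<^sub>C g k) (\<psi> n)) UNIV"
      by (intro has_sum_cmult_right cinner_has_sum bessel_has_sum[OF g a])
    moreover have "((\<lambda>k. cinner (?b k *\<^sub>C g k) (\<psi> n) + cinner ((- 1 * a k) *\<^sub>C v k) (\<psi> n)) has_sum cinner y (\<psi> n)) UNIV"
      unfolding y_def cinner_add_left
      by (intro has_sum_add cinner_has_sum bessel_has_sum[OF g] bessel_has_sum[OF v] sq_summable_scale a wa)
    moreover have "cinner (?b k *\<^sub>C g k) (\<psi> n) + cinner ((- 1 * a k) *\<^sub>C v k) (\<psi> n)
        = \<mu> n * cinner (a k *\<^sub>C g k) (\<psi> n)" for k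
      using imaginary_minus_eigenvalue_nz[of "omega p k" n]
      by (simp add: cinner_scaleC_left gv field_simps)
    ultimately show ?thesis by (simp add: has_sum_unique)
  qed
  then show ?thesis using sq_summable_cinner[of y] by (simp add: spectral_dom_iff)
qed

text \<open>On the character \<open>\<theta>\<^sub>k\<close> the conform integral is a Laplace integral at \<open>i \<omega>\<^sub>k\<close>; it converges by
  hypothesis, and its value is the resolvent because each coordinate converges.\<close>

lemma conform_integral_on_character:
  assumes v: "\<And>t. \<Delta> (T_S p (- t) (theta p k)) = phase (- t) k *\<^sub>C v"
    and lim: "((\<lambda>\<tau>. integral {0..\<tau>} (\<lambda>t. T t (\<Delta> (T_S p (- t) (theta p k))))) \<longlongrightarrow> g) at_top"
  shows "cinner g (\<psi> n) = cinner v (\<psi> n) / (spectral_param k - \<mu> n)"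
proof -
  let ?s = "spectral_param k"
  have s: "Re ?s \<ge> 0" by simp
  have eq: "integral {0..\<tau>} (\<lambda>t. T t (\<Delta> (T_S p (- t) (theta p k))))
      = integral {0..\<tau>} (\<lambda>t. exp (- ?s * complex_of_real t) *\<^sub>C T t v)" for \<tau>
  proof (rule integral_cong)
    fix t assume "t \<in> {0..\<tau>}"
    then show "T t (\<Delta> (T_S p (- t) (theta p k))) = exp (- ?s * complex_of_real t) *\<^sub>C T t v"
      unfolding v by (subst bounded_clinearD(2)[OF T_clinear]) (auto simp: mult.assoc)
  qed
  have "((\<lambda>\<tau>. cinner (integral {0..\<tau>} (\<lambda>t. exp (- ?s * complex_of_real t) *\<^sub>C T t v)) (\<psi> n))
      \<longlongrightarrow> cinner g (\<psi> n)) at_top"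
    by (rule bounded_linear.tendsto[OF bounded_linear_cinner_left lim[unfolded eq]])
  moreover have "\<forall>\<^sub>F \<tau> in at_top. cinner (integral {0..\<tau>} (\<lambda>t. exp (- ?s * complex_of_real t) *\<^sub>C T t v)) (\<psi> n)
      = cinner v (\<psi> n) * (1 - exp ((\<mu> n - ?s) * complex_of_real \<tau>)) / (?s - \<mu> n)"
    using eventually_ge_at_top[of 0] by eventually_elim (rule cinner_finite_laplace[OF s])
  ultimately have "((\<lambda>\<tau>. cinner v (\<psi> n) * (1 - exp ((\<mu> n - ?s) * complex_of_real \<tau>)) / (?s - \<mu> n))
      \<longlongrightarrow> cinner g (\<psi> n)) at_top"
    by (rule Lim_transform_eventually)
  moreover have "((\<lambda>\<tau>. cinner v (\<psi> n) * (1 - exp ((\<mu> n - ?s) * complex_of_real \<tau>)) / (?s - \<mu> n))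
      \<longlongrightarrow> cinner v (\<psi> n) * (1 - 0) / (?s - \<mu> n)) at_top"
    using Re_neg[of n] imaginary_minus_eigenvalue_nz[of "omega p k" n]
    by (intro tendsto_intros exp_tendsto_0) auto
  ultimately show ?thesis
    using tendsto_unique[OF trivial_limit_at_top_linorder] by fastforce
qed

text \<open>Once the plant output of every periodic state \<open>g\<^sub>k\<close> is \<open>1 = \<theta>\<^sub>k(0)\<close>, the periodic part of the output is
  exactly the reference, and the error is the output of a free motion of the plant.\<close>

lemma tracking_error_eq_free_output:
  assumes C: "bounded_clinear C"
    and \<Delta>: "bounded_clinear_on (W_space p f) (W_norm p f) (\<lambda>w. B (L w) + P w)"
    and g: "bessel J f g"
    and gv: "\<And>k n. cinner (g k) (\<psi> n)
      = cinner (B (L (theta p k)) + P (theta p k)) (\<psi> n) / (spectral_param k - \<mu> n)"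
    and Cg: "\<And>k. C (g k) = 1"
    and w0: "w0 \<in> W_space p f" and t: "t \<ge> 0"
  shows "tracking_error p T B C P L z0 w0 t = C (T t (z0 - (\<Sum>\<^sub>\<infinity>k. coef w0 k *\<^sub>C g k)))"
proof -
  let ?v = "\<lambda>k. B (L (theta p k)) + P (theta p k)"
  have a: "sq_summable f (coef w0)" by (rule W_spaceE[OF w0])
  obtain K where v: "bessel K f ?v" using operator_bessel[OF S_dom_subset \<Delta>] by blast
  have "B (L (T_S p s w0)) + P (T_S p s w0) = (\<Sum>\<^sub>\<infinity>k. (phase s k * coef w0 k) *\<^sub>C ?v k)" for s
    using operator_expansion[OF \<Delta> T_S_in_W[OF w0]] by (simp only: coef_T_S[OF w0])
  then have mild: "mild_solution T (\<lambda>s. B (L (T_S p s w0)) + P (T_S p s w0)) z0 t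
      = T t z0 + ((\<Sum>\<^sub>\<infinity>k. (phase t k * coef w0 k) *\<^sub>C g k) - T t (\<Sum>\<^sub>\<infinity>k. coef w0 k *\<^sub>C g k))"
    unfolding mild_solution_def by (simp only: periodic_response[OF t a v g gv])
  have "((\<lambda>k. C ((phase t k * coef w0 k) *\<^sub>C g k)) has_sum C (\<Sum>\<^sub>\<infinity>k. (phase t k * coef w0 k) *\<^sub>C g k)) UNIV"
    by (intro has_sum_bounded_linear[OF bounded_clinearD(1)[OF C]] bessel_has_sum[OF g] sq_summable_group a)
  moreover have "((\<lambda>k. phase t k * coef w0 k * theta p k 0) has_sum T_S p t w0 0) UNIV"
    unfolding T_S_synth by (intro synth_has_sum sq_summable_group a)
  ultimately have "C (\<Sum>\<^sub>\<infinity>k. (phase t k * coef w0 k) *\<^sub>C g k) = T_S p t w0 0"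
    by (intro has_sum_unique) (simp_all add: bounded_clinearD(2)[OF C] Cg)
  then show ?thesis
    unfolding tracking_error_def mild
    by (simp add: bounded_clinearD(3,4)[OF C] bounded_clinearD(4)[OF T_clinear[OF t]])
qed

end

theorem theorem5p1:
  fixes \<phi> \<psi> :: "int \<Rightarrow> 'z::complex_hilbert"
    and \<mu> :: "int \<Rightarrow> complex"
    and \<alpha> c d p :: real
    and A :: "'z \<Rightarrow> 'z" and DA :: "'z set"
    and T_A :: "real \<Rightarrow> 'z \<Rightarrow> 'z"
    and B :: "complex \<Rightarrow> 'z" and C :: "'z \<Rightarrow> complex"
    and f :: "int \<Rightarrow> real"
    and P :: "(real \<Rightarrow> complex) \<Rightarrow> 'z"
    and L :: "(real \<Rightarrow> complex) \<Rightarrow> complex"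
    and H H_d :: "int \<Rightarrow> complex"
  assumes "riesz_basis \<phi>" and "biorthogonal \<phi> \<psi>"
    and "\<forall>n. Re (\<mu> n) < 0"
    and "\<forall>x::real. \<not> (\<i> * complex_of_real x) islimpt range \<mu>"
    and "\<alpha> > 0" and "c > 0" and "d > 0"
    and "\<forall>n. \<bar>Im (\<mu> n)\<bar> \<ge> d \<longrightarrow> Re (\<mu> n) \<le> - c / \<bar>Im (\<mu> n)\<bar> powr \<alpha>"
    and "A = spectral_op \<mu> \<phi> \<psi>" and "DA = spectral_dom \<mu> \<psi>"
    and "c0_semigroup T_A" and "is_generator DA A T_A"
    and "bounded_clinear B" and "bounded_clinear C"
    and "p > 0"
    and "\<forall>k. f k \<ge> 1" and "ell2 (\<lambda>k. inverse (f k))"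
    and "bounded_clinear_on (W_space p f) (W_norm p f) P"
    and "\<forall>k. H k = C (resolvent DA A (\<i> * complex_of_real (omega p k)) (B 1))"
    and "\<forall>k. H_d k = C (resolvent DA A (\<i> * complex_of_real (omega p k)) (P (theta p k)))"
    and assumption1: "\<forall>k. H k \<noteq> 0"
    and assumption2:
      "ell2 (\<lambda>k. inverse (H k) * (1 - H_d k) * complex_of_real (inverse (f k)))"
    and "\<forall>y\<in>W_space p f.
           L y = (\<Sum>\<^sub>\<infinity>k. inverse (H k) * (1 - H_d k) * L2_inner p y (theta p k))"
    and "conform_operator p f T_A (\<lambda>w. B (L w) + P w)"
  shows "SFRP_solved_by p f \<alpha> DA T_A B C P L \<and>
    (\<forall>y_r\<in>W_space p f. let u = (\<lambda>t. L (T_S p t y_r)) in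
       (\<forall>t\<ge>0. ((\<lambda>k. inverse (H k) * (1 - H_d k) * L2_inner p y_r (theta p k)
                      * exp (\<i> * complex_of_real (omega p k * t))) has_sum u t) UNIV) \<and>
       (\<forall>z0. ((\<lambda>t. C (mild_solution T_A (\<lambda>s. B (u s) + P (T_S p s y_r)) z0 t) - y_r t)
                \<longlongrightarrow> 0) at_top))"
proof -
  have Re_neg: "\<And>n. Re (\<mu> n) < 0" and no_lim: "\<And>x. \<not> (\<i> * complex_of_real x) islimpt range \<mu>"
    and Re_bound: "\<And>n. \<bar>Im (\<mu> n)\<bar> \<ge> d \<Longrightarrow> Re (\<mu> n) \<le> - c / \<bar>Im (\<mu> n)\<bar> powr \<alpha>"
    and f1: "\<And>k. f k \<ge> 1"
    using assms(3,4,8,16) by auto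
  have gen: "is_generator (spectral_dom \<mu> \<psi>) (spectral_op \<mu> \<phi> \<psi>) T_A"
    using assms(12) by (simp only: assms(9,10))
  interpret regulated_plant \<phi> \<psi> \<mu> T_A \<alpha> c d p f
    by unfold_locales (fact assms Re_neg no_lim Re_bound f1 gen)+
  note B = \<open>bounded_clinear B\<close> and C = \<open>bounded_clinear C\<close>
  define h where "h k = inverse (H k) * (1 - H_d k)" for k
  let ?\<Delta> = "\<lambda>w. B (L w) + P w"
  let ?W = "W_space p f"
  let ?R = "\<lambda>k. resolvent DA A (\<i> * complex_of_real (omega p k))"
  obtain Kh where Kh: "bessel Kh f h"
    using bessel_functional[OF assumption2] unfolding h_def by blast
  have L: "L y = (\<Sum>\<^sub>\<infinity>k. coef y k *\<^sub>C h k)" if "y \<in> ?W" for y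
    using assms(23) that by (simp add: h_def mult_ac)
  have L_bounded: "bounded_clinear_on ?W (W_norm p f) L"
    by (rule bounded_clinear_on_synthesis[OF Kh L])
  have L_theta: "L (theta p k) = h k" for k
    unfolding L[OF theta_in_W] coef_theta
    by (intro infsumI has_sum_finite_neutralI[of "{k}"]) auto
  have \<Delta>: "bounded_clinear_on ?W (W_norm p f) ?\<Delta>"
    using assms(24) by (simp add: conform_operator_def)
  obtain G where G: "bounded_clinear_on (S_dom p f) (W_norm p f) G"
    and G_lim: "\<And>w. w \<in> S_dom p f \<Longrightarrow>
      ((\<lambda>\<tau>. integral {0..\<tau>} (\<lambda>t. T_A t (?\<Delta> (T_S p (- t) w)))) \<longlongrightarrow> G w) at_top"
    using assms(24) unfolding conform_operator_def by blast
  define g where "g k = G (theta p k)" for k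
  obtain J where J: "bessel J f g"
    using operator_bessel[OF subset_refl G] unfolding g_def by blast
  have \<Delta>_phase: "?\<Delta> (T_S p t (theta p k)) = phase t k *\<^sub>C ?\<Delta> (theta p k)" for t k
    unfolding T_S_theta using \<Delta> theta_in_W[of k] unfolding bounded_clinear_on_def by blast
  have gv: "cinner (g k) (\<psi> n) = cinner (?\<Delta> (theta p k)) (\<psi> n) / (spectral_param k - \<mu> n)" for k n
    unfolding g_def
    by (rule conform_integral_on_character[where \<Delta> = ?\<Delta>, OF \<Delta>_phase G_lim[OF theta_in_S_dom]])
  \<comment> \<open>The gain \<open>h k\<close> solves \<open>H k * h k + H_d k = 1\<close>.\<close>
  have Cg: "C (g k) = 1" for k
  proof -
    have "B (h k) = h k *\<^sub>C B 1"
      using bounded_clinearD(2)[OF B, of "h k" 1] by simp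
    then have "g k = h k *\<^sub>C ?R k (B 1) + ?R k (P (theta p k))"
      unfolding assms(9,10)
      by (intro eq_by_coordinates)
        (simp add: gv L_theta cinner_add_left cinner_scaleC_left cinner_resolvent add_divide_distrib)
    then have "C (g k) = h k * H k + H_d k"
      using assms(19,20) by (simp add: bounded_clinearD(2,3)[OF C])
    moreover have "H k \<noteq> 0" using assumption1 by blast
    ultimately show ?thesis by (simp add: h_def field_simps)
  qed
  note error = tracking_error_eq_free_output[OF C \<Delta> J gv Cg]
  have tracking: "(tracking_error p T_A B C P L z0 w0 \<longlongrightarrow> 0) at_top" if w0: "w0 \<in> ?W" for z0 w0
  proof -
    have "((\<lambda>t. C (T_A t (z0 - (\<Sum>\<^sub>\<infinity>k. coef w0 k *\<^sub>C g k)))) \<longlongrightarrow> C 0) at_top"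
      by (rule bounded_linear.tendsto[OF bounded_clinearD(1)[OF C] T_tendsto_0])
    moreover have "\<forall>\<^sub>F t in at_top. C (T_A t (z0 - (\<Sum>\<^sub>\<infinity>k. coef w0 k *\<^sub>C g k)))
        = tracking_error p T_A B C P L z0 w0 t"
      using eventually_ge_at_top[of 0] by eventually_elim (rule error[OF w0, symmetric])
    ultimately show ?thesis
      unfolding bounded_clinearD(5)[OF C] by (rule Lim_transform_eventually)
  qed
  have rate: "\<exists>m>0. \<forall>t>0. cmod (tracking_error p T_A B C P L z0 w0 t) \<le> m * t powr (- (1 / \<alpha>))"
    if z0: "z0 \<in> DA" and w0: "w0 \<in> S_dom p f" for z0 w0
  proof -
    note w = S_domD[OF w0]
    obtain K where v: "bessel K f (\<lambda>k. ?\<Delta> (theta p k))"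
      using operator_bessel[OF S_dom_subset \<Delta>] by blast
    let ?\<pi> = "\<Sum>\<^sub>\<infinity>k. coef w0 k *\<^sub>C g k"
    have "?\<pi> \<in> spectral_dom \<mu> \<psi>"
      by (rule periodic_state_in_domain[OF W_spaceE(1)[OF w(1)] w(2) v J gv])
    then have "z0 - ?\<pi> \<in> spectral_dom \<mu> \<psi>"
      using z0 sq_summable_add[OF _ sq_summable_scale[of _ _ "- 1"]]
      unfolding assms(10) spectral_dom_iff cinner_diff_left right_diff_distrib by fastforce
    then obtain m where m: "m > 0" "\<And>t. t > 0 \<Longrightarrow> norm (T_A t (z0 - ?\<pi>)) \<le> m * t powr (- (1 / \<alpha>))"
      using domain_decay by blast
    obtain KC where KC: "KC > 0" "\<And>x. cmod (C x) \<le> norm x * KC"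
      using bounded_linear.pos_bounded[OF bounded_clinearD(1)[OF C]] by blast
    have "cmod (tracking_error p T_A B C P L z0 w0 t) \<le> (m * KC) * t powr (- (1 / \<alpha>))" if "t > 0" for t
    proof -
      have "cmod (tracking_error p T_A B C P L z0 w0 t) \<le> norm (T_A t (z0 - ?\<pi>)) * KC"
        unfolding error[OF w(1) less_imp_le[OF that]] by (rule KC)
      also have "\<dots> \<le> m * t powr (- (1 / \<alpha>)) * KC"
        using m(2)[OF that] KC(1) by (intro mult_right_mono) auto
      finally show ?thesis by (simp add: mult_ac)
    qed
    then show ?thesis using m(1) KC(1) by (intro exI[of _ "m * KC"]) auto
  qed
  have "bounded_semigroup T_A"
    using ex_T_bound unfolding bounded_semigroup_def by blast
  then have "SFRP_solved_by p f \<alpha> DA T_A B C P L"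
    unfolding SFRP_solved_by_def
    using L_bounded polynomially_stable_T tracking rate by blast
  moreover have "((\<lambda>k. inverse (H k) * (1 - H_d k) * coef y k * phase t k) has_sum L (T_S p t y)) UNIV"
    if y: "y \<in> ?W" for y t
  proof -
    have "((\<lambda>k. (phase t k * coef y k) *\<^sub>C h k) has_sum (\<Sum>\<^sub>\<infinity>k. (phase t k * coef y k) *\<^sub>C h k)) UNIV"
      by (rule bessel_has_sum[OF Kh sq_summable_group[OF W_spaceE(1)[OF y]]])
    then show ?thesis
      unfolding L[OF T_S_in_W[OF y]] coef_T_S[OF y] by (simp add: h_def mult_ac)
  qed
  moreover have "((\<lambda>t. C (mild_solution T_A (\<lambda>s. B (L (T_S p s y)) + P (T_S p s y)) z0 t) - y t) \<longlongrightarrow> 0) at_top"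
    if y: "y \<in> ?W" for y z0
  proof -
    \<comment> \<open>Shifting a signal by \<open>t\<close> and evaluating at \<open>0\<close> gives its value at \<open>t\<close>.\<close>
    have "T_S p t y 0 = y t" for t
    proof -
      have "T_S p t y 0 = synth (coef y) t"
        unfolding T_S_synth synth_def by (simp add: theta_def mult.commute)
      also have "\<dots> = y t" using W_spaceE(2)[OF y] by (rule fun_cong[symmetric])
      finally show ?thesis .
    qed
    then show ?thesis using tracking[OF y, of z0] unfolding tracking_error_def by simp
  qed
  ultimately show ?thesis unfolding Let_def by blast
qed

end
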